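(* There exists $n_0$ such that for every $n \geq n_0$ the following holds. Let \[\mathcal{C} = \{\sigma \in S_n : \sigma(1) = 1,\ \sigma(i) = i \text{ for some } i > 2\} \cup \{(1\ 2)\},\] which has size $(n-1)! - d_{n-1} - d_{n-2} + 1$. If $\mathcal{A} \subset S_n$ is a non-centred intersecting family, then $|\mathcal{A}| \leq |\mathcal{C}|$. Moreover, equality holds if and only if $\mathcal{A}$ is a double translate of $\mathcal{C}$, i.e. $\mathcal{A} = \pi \mathcal{C} \tau$ for some $\pi, \tau \in S_n$.
   Context: $S_n$ is the symmetric group on $[n]=\{1,\ldots,n\}$; $(1\ 2)$ denotes the transposition swapping 1 and 2. A family $\mathcal{A} \subset S_n$ is intersecting if for any $\sigma,\pi \in \mathcal{A}$ there is some $i \in [n]$ with $\sigma(i)=\pi(i)$. An intersecting family is centred if there exist $i, j \in [n]$ such that every permutation in it maps $i$ to $j$; otherwise it is non-centred. $d_m$ denotes the number of derangements (fixed-point-free permutations) of an $m$-element set. $\pi\mathcal{C}\tau = \{\pi\sigma\tau : \sigma \in \mathcal{C}\}$. *)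

theory Defs
  imports "HOL-Combinatorics.Combinatorics"
begin

definition Sym :: "nat \<Rightarrow> (nat \<Rightarrow> nat) set" where
  "Sym n = {\<sigma>. \<sigma> permutes {1..n}}"

definition intersecting :: "nat \<Rightarrow> (nat \<Rightarrow> nat) set \<Rightarrow> bool" where
  "intersecting n A \<longleftrightarrow> (\<forall>\<sigma>\<in>A. \<forall>\<pi>\<in>A. \<exists>i\<in>{1..n}. \<sigma> i = \<pi> i)"

definition centred :: "nat \<Rightarrow> (nat \<Rightarrow> nat) set \<Rightarrow> bool" where
  "centred n A \<longleftrightarrow> (\<exists>i\<in>{1..n}. \<exists>j\<in>{1..n}. \<forall>\<sigma>\<in>A. \<sigma> i = j)"

definition num_derangements :: "nat \<Rightarrow> nat" where
  "num_derangements m = card {\<sigma>. \<sigma> permutes {1..m} \<and> (\<forall>i\<in>{1..m}. \<sigma> i \<noteq> i)}"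

definition Cfam :: "nat \<Rightarrow> (nat \<Rightarrow> nat) set" where
  "Cfam n = {\<sigma>\<in>Sym n. \<sigma> 1 = 1 \<and> (\<exists>i\<in>{1..n}. i > 2 \<and> \<sigma> i = i)} \<union> {transpose 1 2}"

definition double_translate :: "(nat \<Rightarrow> nat) \<Rightarrow> (nat \<Rightarrow> nat) set \<Rightarrow> (nat \<Rightarrow> nat) \<Rightarrow> (nat \<Rightarrow> nat) set" where
  "double_translate \<pi> C \<tau> = (\<lambda>\<sigma>. \<pi> \<circ> \<sigma> \<circ> \<tau>) ` C"

end

theory Submission
  imports Defs "HOL-Library.FuncSet"
begin

text \<open>
  Identify a permutation with its set of edges \<open>(i, \<sigma> i)\<close>. If no set of edges is contained in
  disproportionately many members of a family, then (spread lemma of Alweiss, Lovasz, Wu and Zhang) a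
  random half of the grid contains a member with probability close to one; hence two such families
  contain disjoint permutations, one found in each half. Let \<open>A\<close> be intersecting with at least
  \<open>|C|\<close> members, and restrict it to a largest edge set \<open>S\<close> that it over-represents by a small power
  of \<open>n\<close> per edge. The restriction is spread, and counting forces \<open>|S| \<le> 1\<close>; disjointness of two spread
  families excludes \<open>S = {}\<close>, so \<open>S = {(a, b)}\<close>. Applying the same restriction to the members
  outside the star \<open>\<sigma> a = b\<close> and comparing it with the star shows that fewer than \<open>(n - 5)!\<close> members
  lie outside. Two members outside the star would exclude at least \<open>(n - 5)!\<close> further
  permutations of the star, so exactly one lies outside, and the family is a translate of \<open>C\<close>.
\<close>

section \<open>A colouring form of the spread lemma\<close>

text \<open>Both sides count the colourings of \<open>Y\<close> with \<open>Suc L\<close> colours,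
  the left one by the class \<open>W\<close> of one fixed colour. This is why
  \<open>L ^ card (Y - W)\<close> serves below as the weight of \<open>W\<close>.\<close>

lemma sum_Pow_power_card_diff:
  fixes L :: nat
  assumes "finite Y"
  shows "(\<Sum>W\<in>Pow Y. L ^ card (Y - W)) = Suc L ^ card Y"
  using prod_add[OF assms, of "\<lambda>_. 1" "\<lambda>_. L"] by simp

lemma sum_Pow_power_card:
  fixes L :: nat
  assumes "finite Y"
  shows "(\<Sum>U\<in>Pow Y. L ^ card U) = Suc L ^ card Y"
  using prod_add[OF assms, of "\<lambda>_. L" "\<lambda>_. 1"] by simp

text \<open>The bound \<open>N\<close> is kept apart from \<open>card I\<close> because the induction shrinks \<open>I\<close> but not \<open>N\<close>.\<close>

definition spread :: "nat \<Rightarrow> nat \<Rightarrow> 'i set \<Rightarrow> ('i \<Rightarrow> 'a set) \<Rightarrow> bool" where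
  "spread r N I \<phi> \<longleftrightarrow> (\<forall>T. finite T \<longrightarrow> card {i\<in>I. T \<subseteq> \<phi> i} * r ^ card T \<le> N)"

definition unshrinkable :: "('i \<Rightarrow> 'a set) \<Rightarrow> 'i set \<Rightarrow> nat \<Rightarrow> 'a set \<Rightarrow> 'i set" where
  "unshrinkable \<phi> I k W = {i\<in>I. \<forall>j\<in>I. \<phi> j \<subseteq> W \<union> \<phi> i \<longrightarrow> k < 2 * card (\<phi> j - W)}"

text \<open>
  A pair \<open>(W, i)\<close> with \<open>i\<close> unshrinkable is encoded by \<open>Z = W \<union> \<phi> i\<close>, the trace \<open>T\<close> on \<open>\<phi> i\<close> of a set \<open>t Z\<close>
  of the family chosen inside \<open>Z\<close>, the index \<open>i\<close>, and \<open>\<phi> i - W\<close>. As \<open>T\<close> has more than \<open>k / 2\<close>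
  elements, spreadness leaves few choices for \<open>i\<close>.
\<close>

lemma unshrinkable_weight_le:
  fixes \<phi> :: "'i \<Rightarrow> 'a set"
  assumes Y: "finite Y" and I: "finite I"
    and sub: "\<And>i. i \<in> I \<Longrightarrow> \<phi> i \<subseteq> Y" and k: "\<And>i. i \<in> I \<Longrightarrow> card (\<phi> i) \<le> k"
    and spr: "spread (Q\<^sup>2) N I \<phi>" and Q: "2 * Suc L \<le> Q"
  shows "Q * (\<Sum>W\<in>Pow Y. L ^ card (Y - W) * card (unshrinkable \<phi> I k W)) \<le> N * Suc L ^ card Y"
proof -
  \<comment> \<open>The choice depends on \<open>Z\<close> alone, so \<open>T\<close> has at most
    \<open>2 ^ k\<close> values once \<open>Z\<close> is known. The default \<open>{}\<close> makes
    \<open>t_card\<close> hold for every \<open>Z\<close>; a code has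
    \<open>\<phi> i \<subseteq> Z\<close> and never meets it.\<close>
  define t where "t Z = (if \<exists>j\<in>I. \<phi> j \<subseteq> Z then \<phi> (SOME j. j \<in> I \<and> \<phi> j \<subseteq> Z) else {})" for Z
  have t_ex: "\<exists>j\<in>I. t Z = \<phi> j \<and> \<phi> j \<subseteq> Z" if "\<exists>j\<in>I. \<phi> j \<subseteq> Z" for Z
  proof -
    have "(SOME j. j \<in> I \<and> \<phi> j \<subseteq> Z) \<in> I \<and> \<phi> (SOME j. j \<in> I \<and> \<phi> j \<subseteq> Z) \<subseteq> Z"
      using someI_ex[of "\<lambda>j. j \<in> I \<and> \<phi> j \<subseteq> Z"] that by blast
    then show ?thesis using that by (auto simp: t_def)
  qed
  have t_card: "finite (t Z) \<and> card (t Z) \<le> k" for Z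
  proof (cases "\<exists>j\<in>I. \<phi> j \<subseteq> Z")
    case True
    then show ?thesis using t_ex[OF True] k sub Y finite_subset by metis
  qed (simp add: t_def)
  have fin\<phi>: "finite (\<phi> i)" if "i \<in> I" for i
    using sub[OF that] Y finite_subset by blast
  define TT where "TT Z = {T. T \<subseteq> t Z \<and> k < 2 * card T}" for Z
  define II where "II T = {i\<in>I. T \<subseteq> \<phi> i}" for T
  define P where "P = Sigma (Pow Y) (unshrinkable \<phi> I k)"
  define D where "D = Sigma (Pow Y) (\<lambda>Z. Sigma (TT Z) (\<lambda>T. Sigma (II T) (\<lambda>i. Pow (\<phi> i))))"
  \<comment> \<open>\<open>Y - W\<close> is the disjoint union of \<open>Y - Z\<close> and
    \<open>U = \<phi> i - W\<close>, so the weight of a pair can be read off its code.\<close>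
  define wt :: "'a set \<times> 'a set \<times> 'i \<times> 'a set \<Rightarrow> nat" where "wt = (\<lambda>(Z, T, i, U). L ^ card (Y - Z) * L ^ card U)"
  define enc where "enc = (\<lambda>(W, i). (W \<union> \<phi> i, t (W \<union> \<phi> i) \<inter> \<phi> i, i, \<phi> i - W))"
  have finTT: "finite (TT Z)" for Z using t_card by (simp add: TT_def)
  have finII: "finite (II T)" for T using I by (simp add: II_def)
  have fin\<phi>': "finite (\<phi> i)" if "i \<in> II T" for i T using that fin\<phi> by (simp add: II_def)
  have finD: "finite D"
    unfolding D_def by (intro finite_SigmaI finTT finII) (use Y fin\<phi> in \<open>auto simp: II_def\<close>)
  have badI: "unshrinkable \<phi> I k W \<subseteq> I" for W by (auto simp: unshrinkable_def)
  have inj: "inj_on enc P"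
  proof (rule inj_onI)
    fix x y assume "x \<in> P" "y \<in> P" and e: "enc x = enc y"
    obtain W i V j where xy: "x = (W, i)" "y = (V, j)" by (cases x, cases y)
    from e have "W \<union> \<phi> i = V \<union> \<phi> i" "\<phi> i - W = \<phi> i - V" "i = j" by (auto simp: enc_def xy)
    then show "x = y" unfolding xy by blast
  qed
  have img: "enc ` P \<subseteq> D"
  proof
    fix z assume "z \<in> enc ` P"
    then obtain W i where W: "W \<subseteq> Y" and i: "i \<in> unshrinkable \<phi> I k W" and z: "z = enc (W, i)"
      by (auto simp: P_def)
    have iI: "i \<in> I" using i badI by auto
    \<comment> \<open>As \<open>\<phi> j - W\<close> lies in \<open>\<phi> i\<close>, the large
      remainder that unshrinkability guarantees for \<open>j\<close> is a large intersection with
      \<open>\<phi> i\<close>.\<close>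
    obtain j where j: "j \<in> I" "t (W \<union> \<phi> i) = \<phi> j" "\<phi> j \<subseteq> W \<union> \<phi> i"
      using t_ex[of "W \<union> \<phi> i"] iI by blast
    have "k < 2 * card (\<phi> j - W)" using i j by (auto simp: unshrinkable_def)
    also have "card (\<phi> j - W) \<le> card (\<phi> j \<inter> \<phi> i)"
      by (rule card_mono) (use j fin\<phi> in auto)
    finally have "k < 2 * card (t (W \<union> \<phi> i) \<inter> \<phi> i)" using j by simp
    then show "z \<in> D" using W sub[OF iI] iI by (auto simp: z enc_def D_def TT_def II_def)
  qed
  have wt: "wt (enc (W, i)) = L ^ card (Y - W)" if "(W, i) \<in> P" for W i
  proof -
    have iI: "i \<in> I" and W: "W \<subseteq> Y" using that badI by (auto simp: P_def)
    have "card (Y - W) = card ((Y - (W \<union> \<phi> i)) \<union> (\<phi> i - W))"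
      using sub[OF iI] by (intro arg_cong[of _ _ card]) auto
    also have "\<dots> = card (Y - (W \<union> \<phi> i)) + card (\<phi> i - W)"
      by (rule card_Un_disjoint) (use Y fin\<phi>[OF iI] in auto)
    finally show ?thesis by (simp add: wt_def enc_def power_add)
  qed
  have finbad: "finite (unshrinkable \<phi> I k W)" for W using badI I finite_subset by blast
  have "(\<Sum>W\<in>Pow Y. L ^ card (Y - W) * card (unshrinkable \<phi> I k W))
      = (\<Sum>W\<in>Pow Y. \<Sum>i\<in>unshrinkable \<phi> I k W. L ^ card (Y - W))" by (simp add: mult.commute)
  also have "\<dots> = (\<Sum>(W, i)\<in>P. L ^ card (Y - W))"
    unfolding P_def by (rule sum.Sigma) (use Y finbad in auto)
  also have "\<dots> = (\<Sum>x\<in>P. wt (enc x))" by (rule sum.cong) (auto simp: wt)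
  also have "\<dots> = sum wt (enc ` P)" using sum.reindex[OF inj, of wt] by (simp add: o_def)
  also have "\<dots> \<le> sum wt D" by (rule sum_mono2[OF finD img]) simp
  also have "sum wt D = (\<Sum>Z\<in>Pow Y. \<Sum>T\<in>TT Z. \<Sum>i\<in>II T. \<Sum>U\<in>Pow (\<phi> i). L ^ card (Y - Z) * L ^ card U)"
    using Y by (simp add: D_def wt_def sum.Sigma finTT finII fin\<phi>')
  also have "\<dots> \<le> (\<Sum>Z\<in>Pow Y. \<Sum>T\<in>TT Z. L ^ card (Y - Z) * (card (II T) * Suc L ^ k))"
  proof (intro sum_mono)
    fix Z T
    have "(\<Sum>U\<in>Pow (\<phi> i). L ^ card (Y - Z) * L ^ card U) \<le> L ^ card (Y - Z) * Suc L ^ k"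
      if "i \<in> II T" for i
    proof -
      have iI: "i \<in> I" using that by (auto simp: II_def)
      have "(\<Sum>U\<in>Pow (\<phi> i). L ^ card (Y - Z) * L ^ card U) = L ^ card (Y - Z) * Suc L ^ card (\<phi> i)"
        by (simp only: sum_distrib_left[symmetric] sum_Pow_power_card[OF fin\<phi>[OF iI]])
      also have "\<dots> \<le> L ^ card (Y - Z) * Suc L ^ k"
        by (intro mult_le_mono2 power_increasing k iI) simp
      finally show ?thesis .
    qed
    from sum_mono[of "II T", OF this]
    show "(\<Sum>i\<in>II T. \<Sum>U\<in>Pow (\<phi> i). L ^ card (Y - Z) * L ^ card U)
        \<le> L ^ card (Y - Z) * (card (II T) * Suc L ^ k)" by (simp add: algebra_simps)
  qed
  finally have le: "(\<Sum>W\<in>Pow Y. L ^ card (Y - W) * card (unshrinkable \<phi> I k W))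
      \<le> (\<Sum>Z\<in>Pow Y. \<Sum>T\<in>TT Z. L ^ card (Y - Z) * (card (II T) * Suc L ^ k))" (is "?B \<le> ?S") .
  have Q0: "Q > 0" using Q by simp
  \<comment> \<open>\<open>T\<close> has more than \<open>k / 2\<close> elements, so spreadness with
    parameter \<open>Q\<^sup>2\<close> yields a factor \<open>Q ^ Suc k\<close>. Of this,
    \<open>Q ^ k\<close> pays for the \<open>2 ^ k\<close> sets \<open>T\<close> and for the factor
    \<open>Suc L ^ k\<close> from the sum over \<open>U\<close>; one \<open>Q\<close> remains as the
    gain.\<close>
  have II_le: "Q ^ Suc k * card (II T) \<le> N" if "T \<in> TT Z" for T Z
  proof -
    have T: "finite T" "Suc k \<le> 2 * card T"
      using that t_card finite_subset by (auto simp: TT_def)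
    have "Q ^ Suc k * card (II T) \<le> Q ^ (2 * card T) * card (II T)"
      by (intro mult_le_mono1 power_increasing T) (use Q0 in simp)
    also have "\<dots> = card (II T) * (Q\<^sup>2) ^ card T" by (simp add: power_mult[of Q 2, symmetric] mult.commute)
    also have "\<dots> \<le> N" using spr T(1) by (simp add: spread_def II_def)
    finally show ?thesis .
  qed
  have "Q ^ Suc k * ?B \<le> Q ^ Suc k * ?S" using le by (rule mult_le_mono2)
  also have "\<dots> = (\<Sum>Z\<in>Pow Y. \<Sum>T\<in>TT Z. L ^ card (Y - Z) * ((Q ^ Suc k * card (II T)) * Suc L ^ k))"
    by (simp only: sum_distrib_left ac_simps)
  also have "\<dots> \<le> (\<Sum>Z\<in>Pow Y. \<Sum>T\<in>TT Z. L ^ card (Y - Z) * (N * Suc L ^ k))"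
    by (intro sum_mono mult_le_mono II_le order_refl) assumption
  also have "\<dots> = (\<Sum>Z\<in>Pow Y. card (TT Z) * (L ^ card (Y - Z) * (N * Suc L ^ k)))" by simp
  also have "\<dots> \<le> (\<Sum>Z\<in>Pow Y. 2 ^ k * (L ^ card (Y - Z) * (N * Suc L ^ k)))"
  proof (intro sum_mono mult_le_mono1)
    fix Z
    have "card (TT Z) \<le> card (Pow (t Z))"
      by (rule card_mono) (use t_card in \<open>auto simp: TT_def\<close>)
    also have "\<dots> \<le> 2 ^ k" using t_card[of Z] by (simp add: card_Pow)
    finally show "card (TT Z) \<le> 2 ^ k" .
  qed
  also have "\<dots> = (\<Sum>Z\<in>Pow Y. L ^ card (Y - Z)) * (N * (2 * Suc L) ^ k)"
    unfolding sum_distrib_right by (rule sum.cong) (simp_all only: power_mult_distrib ac_simps)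
  also have "\<dots> = Suc L ^ card Y * (N * (2 * Suc L) ^ k)" by (simp only: sum_Pow_power_card_diff[OF Y])
  also have "\<dots> \<le> Suc L ^ card Y * (N * Q ^ k)"
    by (intro mult_le_mono2 power_mono Q) simp
  finally have "Q ^ k * (Q * ?B) \<le> Q ^ k * (N * Suc L ^ card Y)" by (simp add: algebra_simps)
  then show ?thesis using Q0 by simp
qed

text \<open>A uniform colouring replaces the random set: these are the failures, where the union of
  the top \<open>m\<close> colour classes contains no \<open>\<phi> i\<close>. Colour classes can be
  revealed one at a time, and \<open>M \<le> c x + m\<close> avoids truncated subtraction.\<close>

definition uncovered :: "nat \<Rightarrow> nat \<Rightarrow> 'a set \<Rightarrow> 'i set \<Rightarrow> ('i \<Rightarrow> 'a set) \<Rightarrow> ('a \<Rightarrow> nat) set" where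
  "uncovered M m Y I \<phi> = {c \<in> Y \<rightarrow>\<^sub>E {..<M}. \<not> (\<exists>i\<in>I. \<forall>x\<in>\<phi> i. M \<le> c x + m)}"

lemma finite_uncovered: "finite Y \<Longrightarrow> finite (uncovered M m Y I \<phi>)"
  unfolding uncovered_def by (rule finite_subset[of _ "Y \<rightarrow>\<^sub>E {..<M}"]) (auto intro: finite_PiE)

text \<open>A colouring splits into its top class \<open>W\<close> and a colouring of
  \<open>Y - W\<close> with \<open>L\<close> colours. If the latter had some
  \<open>\<psi> W i = \<phi> j - W\<close> in its top \<open>m\<close> colours, then
  \<open>\<phi> j\<close> would lie in the top \<open>Suc m\<close> colours of the whole.\<close>

lemma card_uncovered_Suc_le:
  assumes Y: "finite Y"
    and \<psi>: "\<And>W i. W \<subseteq> Y \<Longrightarrow> i \<in> J W \<Longrightarrow> \<exists>j\<in>I. \<psi> W i = \<phi> j - W"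
    and sub: "\<And>i. i \<in> I \<Longrightarrow> \<phi> i \<subseteq> Y"
  shows "card (uncovered (Suc L) (Suc m) Y I \<phi>)
       \<le> (\<Sum>W\<in>Pow Y. card (uncovered L m (Y - W) (J W) (\<psi> W)))"
proof -
  define e where "e c = ({x\<in>Y. c x = L}, restrict c (Y - {x\<in>Y. c x = L}))" for c :: "'a \<Rightarrow> nat"
  let ?D = "Sigma (Pow Y) (\<lambda>W. uncovered L m (Y - W) (J W) (\<psi> W))"
  have "inj_on e (uncovered (Suc L) (Suc m) Y I \<phi>)"
  proof (rule inj_onI)
    fix c d assume c: "c \<in> uncovered (Suc L) (Suc m) Y I \<phi>"
      and d: "d \<in> uncovered (Suc L) (Suc m) Y I \<phi>" and ed: "e c = e d"
    from ed have W: "{x\<in>Y. c x = L} = {x\<in>Y. d x = L}"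
      and r: "restrict c (Y - {x\<in>Y. c x = L}) = restrict d (Y - {x\<in>Y. d x = L})"
      by (auto simp: e_def)
    show "c = d"
    proof (rule PiE_ext[of _ Y "\<lambda>_. {..<Suc L}"])
      fix x assume x: "x \<in> Y"
      show "c x = d x"
      proof (cases "c x = L")
        case True
        then have "x \<in> {x\<in>Y. d x = L}" using W x by blast
        then show ?thesis using True by simp
      next
        case False
        then have "d x \<noteq> L" using W x by blast
        then show ?thesis using fun_cong[OF r, of x] False x by simp
      qed
    qed (use c d in \<open>auto simp: uncovered_def\<close>)
  qed
  moreover have "e ` uncovered (Suc L) (Suc m) Y I \<phi> \<subseteq> ?D"
  proof
    fix z assume "z \<in> e ` uncovered (Suc L) (Suc m) Y I \<phi>"
    then obtain c where c: "c \<in> uncovered (Suc L) (Suc m) Y I \<phi>" and z: "z = e c" by auto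
    define W where "W = {x\<in>Y. c x = L}"
    have cY: "c x < Suc L" if "x \<in> Y" for x using c that by (auto simp: uncovered_def)
    have "restrict c (Y - W) \<in> (Y - W) \<rightarrow>\<^sub>E {..<L}"
    proof (rule restrict_PiE_iff[THEN iffD2], rule ballI)
      fix x assume "x \<in> Y - W"
      then show "c x \<in> {..<L}" using cY[of x] by (auto simp: W_def less_Suc_eq)
    qed
    moreover have False if i: "i \<in> J W" and h: "\<forall>x\<in>\<psi> W i. L \<le> restrict c (Y - W) x + m" for i
    proof -
      obtain j where j: "j \<in> I" "\<psi> W i = \<phi> j - W" using \<psi>[of W i] i by (auto simp: W_def)
      have "Suc L \<le> c x + Suc m" if "x \<in> \<phi> j" for x
      proof (cases "x \<in> W")
        case True then show ?thesis by (simp add: W_def)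
      next
        case False
        then have "x \<in> \<psi> W i" "x \<in> Y - W" using j that sub[OF j(1)] by auto
        then show ?thesis using h by (metis restrict_apply' Suc_le_mono add_Suc_right)
      qed
      then show False using c j by (auto simp: uncovered_def)
    qed
    ultimately have "restrict c (Y - W) \<in> uncovered L m (Y - W) (J W) (\<psi> W)"
      unfolding uncovered_def by blast
    then show "z \<in> ?D" by (auto simp: z e_def W_def)
  qed
  ultimately have "card (uncovered (Suc L) (Suc m) Y I \<phi>) \<le> card ?D"
    by (rule card_inj_on_le) (use Y in \<open>auto intro: finite_uncovered\<close>)
  also have "\<dots> = (\<Sum>W\<in>Pow Y. card (uncovered L m (Y - W) (J W) (\<psi> W)))"
    by (rule card_SigmaI) (use Y in \<open>auto intro: finite_uncovered\<close>)
  finally show ?thesis .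
qed

text \<open>
  Revealing one colour class \<open>W\<close> halves the sets: every \<open>\<phi> i\<close> that is not unshrinkable is replaced by
  a subset of the form \<open>\<phi> j - W\<close>. The factor \<open>card I\<close> absorbs the lost indices additively.
\<close>

theorem card_uncovered_le:
  assumes "finite Y" "finite I" "\<And>i. i \<in> I \<Longrightarrow> \<phi> i \<subseteq> Y" "\<And>i. i \<in> I \<Longrightarrow> card (\<phi> i) < 2 ^ m"
    and "spread (Q\<^sup>2) N I \<phi>" "2 * M \<le> Q" "m \<le> M"
  shows "Q * card (uncovered M m Y I \<phi>) * card I \<le> m * N * M ^ card Y"
  using assms
proof (induction m arbitrary: M Y I \<phi>)
  case 0
  show ?case
  proof (cases "I = {}")
    case False
    then obtain i where i: "i \<in> I" by auto
    then have "\<phi> i = {}" using 0 finite_subset[of "\<phi> i" Y] by force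
    then have "uncovered M 0 Y I \<phi> = {}" using i by (auto simp: uncovered_def)
    then show ?thesis by simp
  qed simp
next
  case (Suc m)
  note Y = Suc.prems(1) and I = Suc.prems(2) and sub = Suc.prems(3) and spr = Suc.prems(5)
  obtain L where M: "M = Suc L" using Suc.prems(7) by (cases M) auto
  \<comment> \<open>The largest size that the hypothesis permits; being odd, it turns
    \<open>2 * card (\<psi> W i) \<le> k\<close> into the strict bound \<open>2 ^ m\<close>.\<close>
  define k where "k = 2 ^ Suc m - (1::nat)"
  define J where "J W = I - unshrinkable \<phi> I k W" for W
  have "\<exists>j. j \<in> I \<and> \<phi> j \<subseteq> W \<union> \<phi> i \<and> 2 * card (\<phi> j - W) \<le> k" if "i \<in> J W" for W i
    using that by (auto simp: J_def unshrinkable_def not_less)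
  then have "\<forall>W i. \<exists>j. i \<in> J W \<longrightarrow> j \<in> I \<and> \<phi> j \<subseteq> W \<union> \<phi> i \<and> 2 * card (\<phi> j - W) \<le> k"
    by blast
  then obtain g where g: "\<And>W i. i \<in> J W \<Longrightarrow> g W i \<in> I \<and> \<phi> (g W i) \<subseteq> W \<union> \<phi> i \<and> 2 * card (\<phi> (g W i) - W) \<le> k"
    unfolding choice_iff by blast
  define \<psi> where "\<psi> W i = \<phi> (g W i) - W" for W i
  have \<psi>sub: "\<psi> W i \<subseteq> \<phi> i" if "i \<in> J W" for W i using g[OF that] by (auto simp: \<psi>_def)
  have IH: "Q * card (uncovered L m (Y - W) (J W) (\<psi> W)) * card (J W) \<le> m * N * L ^ card (Y - W)" for W
  proof (rule Suc.IH)
    show "finite (Y - W)" "finite (J W)" using Y I by (auto simp: J_def)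
    show "\<psi> W i \<subseteq> Y - W" if "i \<in> J W" for i using g[OF that] sub by (auto simp: \<psi>_def)
    show "card (\<psi> W i) < 2 ^ m" if "i \<in> J W" for i
    proof -
      have "2 * card (\<psi> W i) \<le> k" using g[OF that] by (simp add: \<psi>_def)
      also have "k < 2 * 2 ^ m" by (simp add: k_def)
      finally show ?thesis by simp
    qed
    show "spread (Q\<^sup>2) N (J W) (\<psi> W)" unfolding spread_def
    proof (intro allI impI)
      fix T :: "'a set" assume T: "finite T"
      have "card {i\<in>J W. T \<subseteq> \<psi> W i} \<le> card {i\<in>I. T \<subseteq> \<phi> i}"
        by (rule card_mono) (use I \<psi>sub in \<open>auto simp: J_def\<close>)
      then have "card {i\<in>J W. T \<subseteq> \<psi> W i} * Q\<^sup>2 ^ card T \<le> card {i\<in>I. T \<subseteq> \<phi> i} * Q\<^sup>2 ^ card T"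
        by (rule mult_le_mono1)
      also have "\<dots> \<le> N" using spr T by (simp add: spread_def)
      finally show "card {i\<in>J W. T \<subseteq> \<psi> W i} * Q\<^sup>2 ^ card T \<le> N" .
    qed
    show "2 * L \<le> Q" "m \<le> L" using Suc.prems M by auto
  qed
  let ?u = "\<lambda>W. card (uncovered L m (Y - W) (J W) (\<psi> W))"
  let ?b = "\<lambda>W. card (unshrinkable \<phi> I k W)"
  have cI: "card I = card (J W) + ?b W" for W
  proof -
    have s: "unshrinkable \<phi> I k W \<subseteq> I" by (auto simp: unshrinkable_def)
    then show ?thesis using card_Diff_subset[of "unshrinkable \<phi> I k W" I] card_mono[OF I s] I finite_subset
      by (fastforce simp: J_def)
  qed
  have ub: "?u W \<le> L ^ card (Y - W)" for W
  proof -
    have "?u W \<le> card ((Y - W) \<rightarrow>\<^sub>E {..<L})"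
      by (rule card_mono) (use Y in \<open>auto simp: uncovered_def intro: finite_PiE\<close>)
    then show ?thesis using Y by (simp add: card_PiE)
  qed
  have "card (uncovered M (Suc m) Y I \<phi>) \<le> (\<Sum>W\<in>Pow Y. ?u W)"
    unfolding M by (rule card_uncovered_Suc_le[OF Y _ sub]) (use g in \<open>auto simp: \<psi>_def\<close>)
  then have "Q * card (uncovered M (Suc m) Y I \<phi>) * card I \<le> Q * (\<Sum>W\<in>Pow Y. ?u W) * card I"
    by (intro mult_le_mono1 mult_le_mono2)
  also have "\<dots> = (\<Sum>W\<in>Pow Y. Q * ?u W * card I)" by (simp only: sum_distrib_left sum_distrib_right)
  \<comment> \<open>The surviving indices are charged to the induction hypothesis. For the lost ones
    the failures are bounded by all colourings of \<open>Y - W\<close>, which is the weight in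
    \<open>unshrinkable_weight_le\<close>.\<close>
  also have "\<dots> = (\<Sum>W\<in>Pow Y. Q * ?u W * card (J W) + Q * (?u W * ?b W))"
    by (rule sum.cong[OF refl], subst cI) (simp only: algebra_simps)
  also have "\<dots> \<le> (\<Sum>W\<in>Pow Y. m * N * L ^ card (Y - W) + Q * (L ^ card (Y - W) * ?b W))"
    by (intro sum_mono add_mono IH mult_le_mono ub order_refl)
  also have "\<dots> = m * N * (\<Sum>W\<in>Pow Y. L ^ card (Y - W)) + Q * (\<Sum>W\<in>Pow Y. L ^ card (Y - W) * ?b W)"
    by (simp only: sum.distrib sum_distrib_left)
  also have "\<dots> \<le> m * N * Suc L ^ card Y + N * Suc L ^ card Y"
  proof -
    have "Q * (\<Sum>W\<in>Pow Y. L ^ card (Y - W) * ?b W) \<le> N * Suc L ^ card Y"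
    proof (rule unshrinkable_weight_le[OF Y I sub _ spr])
      show "card (\<phi> i) \<le> k" if "i \<in> I" for i using Suc.prems(4)[OF that] by (simp add: k_def)
      show "2 * Suc L \<le> Q" using Suc.prems M by simp
    qed
    then show ?thesis by (simp only: sum_Pow_power_card_diff[OF Y])
  qed
  finally show ?case by (simp add: M algebra_simps)
qed

section \<open>Intersecting families concentrate on a star\<close>

definition edges :: "nat \<Rightarrow> (nat \<Rightarrow> nat) \<Rightarrow> (nat \<times> nat) set" where
  "edges n \<sigma> = (\<lambda>i. (i, \<sigma> i)) ` {1..n}"

definition containing :: "nat \<Rightarrow> (nat \<Rightarrow> nat) set \<Rightarrow> (nat \<times> nat) set \<Rightarrow> (nat \<Rightarrow> nat) set" where
  "containing n A S = {\<sigma>\<in>A. S \<subseteq> edges n \<sigma>}"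

lemma finite_Sym: "finite (Sym n)"
  unfolding Sym_def by (simp add: finite_permutations)

lemma finite_edges: "finite (edges n \<sigma>)"
  by (simp add: edges_def)

lemma card_edges: "card (edges n \<sigma>) = n"
  using card_image[of "\<lambda>i. (i, \<sigma> i)" "{1..n}"] by (simp add: edges_def inj_on_def)

lemma edges_subset:
  assumes "\<sigma> \<in> Sym n"
  shows "edges n \<sigma> \<subseteq> {1..n} \<times> {1..n}"
  unfolding edges_def
proof (rule image_subsetI)
  fix i assume "i \<in> {1..n}"
  moreover have "\<sigma> permutes {1..n}" using assms by (simp add: Sym_def)
  ultimately show "(i, \<sigma> i) \<in> {1..n} \<times> {1..n}"
    using permutes_in_image[of \<sigma> "{1..n}" i] by blast
qed

lemma mem_edges: "(i, j) \<in> edges n \<sigma> \<longleftrightarrow> i \<in> {1..n} \<and> \<sigma> i = j"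
  by (auto simp: edges_def)

lemma containing_empty [simp]: "containing n A {} = A"
  by (simp add: containing_def)

text \<open>Composing with the inverse of one fixed member \<open>s\<close> turns all members into
  permutations that fix every first coordinate occurring in \<open>S\<close>.\<close>

lemma card_containing_le:
  assumes A: "A \<subseteq> Sym n"
  shows "card (containing n A S) \<le> fact (n - card S)"
proof (cases "containing n A S = {}")
  case False
  then obtain s where s: "s \<in> A" "S \<subseteq> edges n s" by (auto simp: containing_def)
  have sp: "s permutes {1..n}" using A s by (auto simp: Sym_def)
  have "inj_on fst S" by (rule inj_on_subset[OF _ s(2)]) (auto simp: inj_on_def edges_def)
  then have cS: "card (fst ` S) = card S" by (rule card_image)
  have fS: "fst ` S \<subseteq> {1..n}" using s(2) by (auto simp: edges_def)
  let ?D = "{1..n} - fst ` S"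
  have "card (containing n A S) \<le> card {p. p permutes ?D}"
  proof (rule card_inj_on_le[of "\<lambda>\<sigma>. inv s \<circ> \<sigma>"])
    show "inj_on (\<lambda>\<sigma>. inv s \<circ> \<sigma>) (containing n A S)"
    proof (rule inj_onI)
      fix x y assume "inv s \<circ> x = inv s \<circ> y"
      then have "s \<circ> (inv s \<circ> x) = s \<circ> (inv s \<circ> y)" by simp
      then show "x = y" using permutes_inv_o(1)[OF sp] by (simp add: o_assoc)
    qed
    show "(\<lambda>\<sigma>. inv s \<circ> \<sigma>) ` containing n A S \<subseteq> {p. p permutes ?D}"
    proof clarify
      fix \<sigma> assume \<sigma>: "\<sigma> \<in> containing n A S"
      have "\<sigma> permutes {1..n}" using \<sigma> A by (auto simp: containing_def Sym_def)
      then have "(inv s \<circ> \<sigma>) permutes {1..n}" by (intro permutes_compose permutes_inv sp)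
      then show "(inv s \<circ> \<sigma>) permutes ?D"
      proof (rule permutes_superset)
        fix x assume "x \<in> {1..n} - ?D"
        then obtain y where "(x, y) \<in> S" by auto
        then have "\<sigma> x = y" "s x = y" using \<sigma> s(2) by (auto simp: containing_def mem_edges)
        then show "(inv s \<circ> \<sigma>) x = x" using permutes_inverses(2)[OF sp, of x] by simp
      qed
    qed
    show "finite {p. p permutes ?D}" by (simp add: finite_permutations)
  qed
  also have "\<dots> = fact (card ?D)" by (rule card_permutations) auto
  also have "card ?D = n - card S" using fS cS by (simp add: card_Diff_subset finite_subset)
  finally show ?thesis .
qed simp

text \<open>Single factors of the falling factorial can be below \<open>R\<close>. Pairing the
  factor at \<open>i\<close> with the one at \<open>j - 1 - i\<close> gives products of at least
  \<open>m\<close>, as \<open>x * y \<ge> x + y - 1\<close> for positive factors; so its square is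
  at least \<open>m ^ j\<close>.\<close>

lemma power_mult_fact_diff_le:
  assumes R: "R\<^sup>2 \<le> (m::nat)" and j: "j \<le> m"
  shows "R ^ j * fact (m - j) \<le> (fact m :: nat)"
proof -
  define P where "P = (\<Prod>i<j. m - i)"
  have fm: "fact m = fact (m - j) * P" using j unfolding P_def
  proof (induction j)
    case (Suc j)
    have "fact (m - j) = (m - j) * fact (m - Suc j)" using Suc.prems
      by (metis Suc_diff_Suc Suc_le_lessD fact_Suc of_nat_id)
    then show ?case using Suc by (simp add: algebra_simps)
  qed simp
  have "(R ^ j)\<^sup>2 = (R\<^sup>2) ^ j" by (simp add: power_mult[symmetric] mult.commute)
  also have "\<dots> \<le> m ^ j" by (rule power_mono[OF R]) simp
  also have "\<dots> = (\<Prod>i<j. m)" by simp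
  also have "\<dots> \<le> (\<Prod>i<j. (m - i) * (m - (j - Suc i)))"
  proof (rule prod_mono, safe)
    fix i assume "i < j"
    then have ab: "m - i = Suc (m - Suc i)" "m - (j - Suc i) = Suc (m - j + i)"
      "m \<le> Suc ((m - Suc i) + (m - j + i))" using j by linarith+
    show "m \<le> (m - i) * (m - (j - Suc i))" unfolding ab(1,2) using ab(3) by simp
  qed
  also have "\<dots> = P * P"
    unfolding prod.distrib P_def using prod.nat_diff_reindex[of "\<lambda>i. m - i" j] by simp
  also have "\<dots> = P\<^sup>2" by (simp add: power2_eq_square)
  finally have "R ^ j \<le> P" by (simp add: power_mono_iff)
  then show ?thesis unfolding fm by (simp add: mult.commute)
qed

text \<open>\<open>R ^ s * fact (n - s)\<close> will bound a family whose restriction has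
  \<open>s\<close> edges; the worst case is the smallest admissible \<open>s\<close>.\<close>

lemma power_mult_fact_diff_mono:
  assumes R: "R\<^sup>2 \<le> (n::nat) - r" and "r \<le> s" "s \<le> n"
  shows "R ^ s * fact (n - s) \<le> R ^ r * (fact (n - r) :: nat)"
proof -
  have "R ^ (s - r) * fact (n - r - (s - r)) \<le> (fact (n - r) :: nat)"
    by (rule power_mult_fact_diff_le[OF R]) (use assms in simp)
  then have "R ^ r * (R ^ (s - r) * fact (n - s)) \<le> R ^ r * (fact (n - r) :: nat)"
    using assms by simp
  also have "R ^ r * (R ^ (s - r) * fact (n - s)) = R ^ s * fact (n - s)"
    using assms by (simp flip: power_add mult.assoc)
  finally show ?thesis .
qed

text \<open>\<open>{}\<close> satisfies the size inequality, so a largest such \<open>S\<close>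
  exists. A set \<open>T\<close> violating spreadness could be added to \<open>S\<close> while
  keeping the inequality, against maximality.\<close>

lemma ex_spread_restriction:
  assumes A: "A \<subseteq> Sym n" "A \<noteq> {}" and R: "R > 0"
  obtains S where "finite S" "card S \<le> n" "card A \<le> card (containing n A S) * R ^ card S"
    "spread R (card (containing n A S)) (containing n A S) (\<lambda>\<sigma>. edges n \<sigma> - S)"
proof -
  have finA: "finite A" using A finite_Sym finite_subset by blast
  define K where "K = {S. S \<subseteq> {1..n} \<times> {1..n} \<and> card A \<le> card (containing n A S) * R ^ card S}"
  have "finite K" by (rule finite_subset[of _ "Pow ({1..n} \<times> {1..n})"]) (auto simp: K_def)
  moreover have "{} \<in> K" by (simp add: K_def)
  ultimately obtain S where S: "S \<in> K" and max: "\<And>T. T \<in> K \<Longrightarrow> card T \<le> card S"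
  proof -
    assume fin: "finite K" and "{} \<in> K"
    then have "Max (card ` K) \<in> card ` K" by (intro Max_in) auto
    then obtain S where "S \<in> K" "card S = Max (card ` K)" by force
    then show ?thesis using that[of S] fin by simp
  qed
  have finS: "finite S" using S finite_subset by (fastforce simp: K_def)
  let ?A = "containing n A S"
  have le: "card A \<le> card ?A * R ^ card S" using S by (simp add: K_def)
  have "card A > 0" using A finA by (simp add: card_gt_0_iff)
  then have "?A \<noteq> {}" using le by auto
  then obtain s where "s \<in> A" "S \<subseteq> edges n s" by (auto simp: containing_def)
  then have cS: "card S \<le> n" using card_mono[OF finite_edges] card_edges by metis
  have "spread R (card ?A) ?A (\<lambda>\<sigma>. edges n \<sigma> - S)"
    unfolding spread_def
  proof (intro allI impI)
    fix T :: "(nat \<times> nat) set" assume T: "finite T"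
    let ?B = "{\<sigma> \<in> ?A. T \<subseteq> edges n \<sigma> - S}"
    show "card ?B * R ^ card T \<le> card ?A"
    proof (cases "?B = {} \<or> T = {}")
      case True
      then show ?thesis
      proof
        assume "?B = {}" then show ?thesis by (metis card.empty mult_zero_left zero_le)
      next
        assume T: "T = {}"
        then show ?thesis by simp
      qed
    next
      case False
      then obtain t where t: "t \<in> A" "T \<subseteq> edges n t - S" "S \<subseteq> edges n t" by (auto simp: containing_def)
      then have disj: "T \<inter> S = {}" by auto
      have B: "?B = containing n A (S \<union> T)" using disj by (auto simp: containing_def)
      have card: "card (S \<union> T) = card S + card T" using card_Un_disjoint[OF finS T] disj by auto
      have "S \<union> T \<subseteq> {1..n} \<times> {1..n}" using t edges_subset[of t n] A by blast
      moreover have "S \<union> T \<notin> K" using max[of "S \<union> T"] card False T by (auto simp: card_gt_0_iff)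
      ultimately have "card ?B * R ^ (card S + card T) < card A"
        unfolding B by (simp add: K_def card not_le)
      also note le
      finally have "R ^ card S * (card ?B * R ^ card T) < R ^ card S * card ?A"
        by (simp add: power_add algebra_simps)
      then show ?thesis using R by simp
    qed
  qed
  then show ?thesis using that finS cS le by blast
qed

text \<open>Colour the grid with \<open>2 * m\<close> colours. \<open>F\<close> has a member with
  its edges outside \<open>S\<close> in the upper half, and \<open>G\<close> one with its edges
  outside \<open>T\<close> in the lower half, each failing for at most a quarter of the colourings;
  so some colouring serves both. A common edge would avoid \<open>S\<close> by \<open>GS\<close> and
  \<open>T\<close> by \<open>FT\<close>, hence lie in both halves.\<close>

lemma ex_disjoint_pair:
  assumes F: "F \<subseteq> Sym n" "F \<noteq> {}" and G: "G \<subseteq> Sym n" "G \<noteq> {}"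
    and sF: "spread (Q\<^sup>2) NF F (\<lambda>\<sigma>. edges n \<sigma> - S)" "NF \<le> 2 * card F"
    and sG: "spread (Q\<^sup>2) NG G (\<lambda>\<sigma>. edges n \<sigma> - T)" "NG \<le> 2 * card G"
    and FT: "\<And>f. f \<in> F \<Longrightarrow> edges n f \<inter> T = {}" and GS: "\<And>g. g \<in> G \<Longrightarrow> edges n g \<inter> S = {}"
    and n: "n < 2 ^ m" and m: "m > 0" "8 * m \<le> Q"
  shows "\<exists>f\<in>F. \<exists>g\<in>G. \<forall>i\<in>{1..n}. f i \<noteq> g i"
proof -
  define Y where "Y = {1..n} \<times> {1..n}"
  define M where "M = 2 * m"
  have Y: "finite Y" by (simp add: Y_def)
  \<comment> \<open>The failure proportion is at most \<open>m * N / (Q * card H)\<close>, which is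
    at most 1/4 by \<open>N \<le> 2 * card H\<close> and \<open>8 * m \<le> Q\<close>. The factor 2
    leaves room for passing to half of a spread family.\<close>
  have bound: "4 * card (uncovered M m Y H (\<lambda>\<sigma>. edges n \<sigma> - U)) \<le> M ^ card Y"
    if H: "H \<subseteq> Sym n" "H \<noteq> {}" and s: "spread (Q\<^sup>2) N H (\<lambda>\<sigma>. edges n \<sigma> - U)" "N \<le> 2 * card H" for H U N
  proof -
    let ?u = "card (uncovered M m Y H (\<lambda>\<sigma>. edges n \<sigma> - U))"
    have fH: "finite H" using H finite_Sym finite_subset by blast
    have "Q * ?u * card H \<le> m * N * M ^ card Y"
    proof (rule card_uncovered_le[OF Y fH _ _ s(1)])
      show "edges n i - U \<subseteq> Y" if "i \<in> H" for i using edges_subset[of i n] that H by (auto simp: Y_def)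
      show "card (edges n i - U) < 2 ^ m" if "i \<in> H" for i
        using card_mono[OF finite_edges[of n i], of "edges n i - U"] card_edges[of n i] n by auto
    qed (use m in \<open>auto simp: M_def\<close>)
    also have "\<dots> \<le> m * (2 * card H) * M ^ card Y" using s by simp
    finally have "card H * (Q * ?u) \<le> card H * (2 * m * M ^ card Y)" by (simp add: algebra_simps)
    then have "Q * ?u \<le> 2 * m * M ^ card Y" using H fH by (simp add: card_gt_0_iff)
    moreover have "8 * m * ?u \<le> Q * ?u" using m by simp
    ultimately have "2 * m * (4 * ?u) \<le> 2 * m * M ^ card Y" by linarith
    then show ?thesis using m by simp
  qed
  define uF where "uF = uncovered M m Y F (\<lambda>\<sigma>. edges n \<sigma> - S)"
  define uG where "uG = uncovered M m Y G (\<lambda>\<sigma>. edges n \<sigma> - T)"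
  \<comment> \<open>Reversing the order of the colours exchanges the two halves, so the lower half
    is also handled by \<open>uncovered\<close>.\<close>
  define flip where "flip c = restrict (\<lambda>x. M - 1 - c x) Y" for c :: "nat \<times> nat \<Rightarrow> nat"
  have fin: "finite uF" "finite uG" by (auto simp: uF_def uG_def intro: finite_uncovered Y)
  have "card (uF \<union> flip ` uG) \<le> card uF + card (flip ` uG)" by (rule card_Un_le)
  also have "\<dots> \<le> card uF + card uG" using card_image_le[OF fin(2)] by simp
  also have "\<dots> < M ^ card Y"
  proof -
    have "4 * card uF \<le> M ^ card Y" "4 * card uG \<le> M ^ card Y"
      unfolding uF_def uG_def by (rule bound[OF F sF], rule bound[OF G sG])
    moreover have "M ^ card Y > 0" using m by (simp add: M_def)
    ultimately show ?thesis by linarith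
  qed
  also have "\<dots> = card (Y \<rightarrow>\<^sub>E {..<M})" using Y by (simp add: card_PiE)
  finally have "\<not> (Y \<rightarrow>\<^sub>E {..<M}) \<subseteq> uF \<union> flip ` uG"
    using card_mono[of "uF \<union> flip ` uG" "Y \<rightarrow>\<^sub>E {..<M}"] fin by auto
  then obtain c where c: "c \<in> Y \<rightarrow>\<^sub>E {..<M}" "c \<notin> uF" "c \<notin> flip ` uG" by blast
  have cM: "c x < M" if "x \<in> Y" for x using c that by auto
  have "flip (flip c) = c"
  proof
    fix x show "flip (flip c) x = c x"
      using cM[of x] PiE_arb[OF c(1), of x] by (cases "x \<in> Y") (auto simp: flip_def)
  qed
  then have "flip c \<notin> uG" using c(3) by (metis imageI)
  moreover have "flip c \<in> Y \<rightarrow>\<^sub>E {..<M}"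
    unfolding flip_def restrict_PiE_iff using m by (auto simp: M_def)
  ultimately obtain g where g: "g \<in> G" "\<And>x. x \<in> edges n g - T \<Longrightarrow> M \<le> flip c x + m"
    by (auto simp: uG_def uncovered_def)
  obtain f where f: "f \<in> F" "\<And>x. x \<in> edges n f - S \<Longrightarrow> M \<le> c x + m"
    using c by (auto simp: uF_def uncovered_def)
  have "f i \<noteq> g i" if i: "i \<in> {1..n}" for i
  proof
    assume eq: "f i = g i"
    let ?x = "(i, f i)"
    have x: "?x \<in> edges n f" "?x \<in> edges n g" using i eq by (auto simp: mem_edges)
    then have "?x \<notin> S" "?x \<notin> T" using FT[OF f(1)] GS[OF g(1)] by auto
    moreover have xY: "?x \<in> Y" using x(1) edges_subset[of f n] f(1) F(1) unfolding Y_def by blast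
    ultimately have "M \<le> c ?x + m" "M \<le> (M - 1 - c ?x) + m"
      using f(2)[of ?x] g(2)[of ?x] x by (auto simp: flip_def)
    then show False using cM[OF xY] by (simp add: M_def)
  qed
  then show ?thesis using f g by blast
qed

text \<open>\<open>(a, b)\<close> is the single edge of the spread restriction of \<open>A\<close>.
  The bound \<open>fact (n - 5)\<close> is chosen to match
  \<open>card_hitting_avoiding\<close>.\<close>

lemma intersecting_concentrated:
  assumes A: "A \<subseteq> Sym n" "intersecting n A"
    and n: "n < 2 ^ m" and m: "m > 0" "8 * m \<le> Q" and Rn: "(Q\<^sup>2) ^ 6 + 10 \<le> n"
    and big: "(Q\<^sup>2)\<^sup>2 * fact (n - 2) < card A"
  shows "\<exists>a\<in>{1..n}. \<exists>b\<in>{1..n}. card {\<sigma>\<in>A. \<sigma> a \<noteq> b} < fact (n - 5)"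
proof -
  define R where "R = Q\<^sup>2"
  have "8\<^sup>2 \<le> Q\<^sup>2" by (rule power_mono) (use m in auto)
  then have R: "R \<ge> 64" by (simp add: R_def)
  have R26: "R\<^sup>2 \<le> R ^ 6" using R by (intro power_increasing) auto
  have finA: "finite A" using A finite_Sym finite_subset by blast
  have A0: "A \<noteq> {}" using big by auto
  have noFG: False if "F \<subseteq> A" "G \<subseteq> A" "\<exists>f\<in>F. \<exists>g\<in>G. \<forall>i\<in>{1..n}. f i \<noteq> g i" for F G
    using that A(2) unfolding intersecting_def by blast
  obtain S where S: "finite S" "card S \<le> n" "card A \<le> card (containing n A S) * R ^ card S"
    "spread R (card (containing n A S)) (containing n A S) (\<lambda>\<sigma>. edges n \<sigma> - S)"
    using ex_spread_restriction[OF A(1) A0, of R] R by auto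
  define F where "F = containing n A S"
  have FA: "F \<subseteq> A" by (auto simp: F_def containing_def)
  have finF: "finite F" using FA finA finite_subset by blast
  have F0: "F \<noteq> {}" using S(3) A0 finA by (auto simp: F_def)
  have "card S < 2"
  proof (rule ccontr)
    assume "\<not> card S < 2"
    \<comment> \<open>With two or more edges in \<open>S\<close>, \<open>A\<close> would have at
      most \<open>R\<^sup>2 * fact (n - 2)\<close> members, the threshold in
      \<open>big\<close>.\<close>
    have "card A \<le> R ^ card S * fact (n - card S)"
      using le_trans[OF S(3) mult_le_mono1[OF card_containing_le[OF A(1)]]] by (simp only: mult.commute)
    also have "\<dots> \<le> R ^ 2 * fact (n - 2)"
      by (rule power_mult_fact_diff_mono) (use R26 Rn S \<open>\<not> card S < 2\<close> in \<open>auto simp: R_def\<close>)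
    finally show False using big by (simp add: R_def)
  qed
  moreover have "card S \<noteq> 0"
  proof
    assume "card S = 0"
    \<comment> \<open>Now \<open>A\<close> itself is spread, and pairing it with itself yields two
      disjoint members.\<close>
    then have "S = {}" using S by simp
    then have "spread (Q\<^sup>2) (card A) A (\<lambda>\<sigma>. edges n \<sigma> - {})" using S(4) by (simp add: R_def)
    from ex_disjoint_pair[OF A(1) A0 A(1) A0 this _ this _ _ _ n m]
    show False using noFG[of A A] by auto
  qed
  ultimately have "card S = 1" by linarith
  then obtain a b where ab: "S = {(a, b)}" by (auto simp: card_1_singleton_iff)
  obtain f where f: "f \<in> F" using F0 by auto
  have abn: "a \<in> {1..n}" "b \<in> {1..n}"
    using f A(1) edges_subset[of f n] FA by (fastforce simp: F_def containing_def ab)+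
  define B where "B = {\<sigma>\<in>A. \<sigma> a \<noteq> b}"
  have BA: "B \<subseteq> A" by (auto simp: B_def)
  have BSym: "B \<subseteq> Sym n" using BA A(1) by blast
  have BS: "edges n g \<inter> S = {}" if "g \<in> B" for g using that by (auto simp: B_def ab mem_edges)
  have "card B < fact (n - 5)"
  proof (rule ccontr)
    assume "\<not> card B < fact (n - 5)"
    then have Bbig: "fact (n - 5) \<le> card B" by simp
    moreover have "(fact (n - 5) :: nat) > 0" by simp
    ultimately have B0: "B \<noteq> {}" by auto
    obtain T where T: "finite T" "card T \<le> n" "card B \<le> card (containing n B T) * R ^ card T"
      "spread R (card (containing n B T)) (containing n B T) (\<lambda>\<sigma>. edges n \<sigma> - T)"
      using ex_spread_restriction[of B n R] B0 R BA A(1) by auto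
    have "card T < 6"
    proof (rule ccontr)
      assume "\<not> card T < 6"
      \<comment> \<open>With six or more edges in \<open>T\<close>, \<open>B\<close> would have at
        most \<open>R ^ 6 * fact (n - 6)\<close> members, fewer than \<open>fact (n - 5)\<close>
        because \<open>R ^ 6 + 10 \<le> n\<close>.\<close>
      have "card B \<le> R ^ card T * fact (n - card T)"
        using le_trans[OF T(3) mult_le_mono1[OF card_containing_le[OF BSym]]] by (simp only: mult.commute)
      also have "\<dots> \<le> R ^ 6 * fact (n - 6)"
        by (rule power_mult_fact_diff_mono) (use R26 Rn T \<open>\<not> card T < 6\<close> in \<open>auto simp: R_def\<close>)
      also have "\<dots> < (n - 5) * fact (n - 6)"
        by (rule mult_strict_right_mono) (use Rn in \<open>auto simp: R_def\<close>)
      also have "\<dots> = fact (n - 5)"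
      proof -
        have "n - 5 = Suc (n - 6)" using Rn by simp
        then show ?thesis by simp
      qed
      finally show False using Bbig by simp
    qed
    define G where "G = containing n B T"
    have finB: "finite B" using BA finA finite_subset by blast
    then have "0 < card (containing n B T)" using T(3) B0 by (metis card_gt_0_iff gr0I le_zero_eq mult_zero_left)
    then have G: "G \<subseteq> A" "G \<subseteq> B" "G \<noteq> {}" "finite G"
      using BA finB by (force simp: G_def containing_def card_gt_0_iff)+
    then obtain g where g: "g \<in> G" by auto
    have TS: "T \<inter> S = {}" using g BS by (auto simp: G_def containing_def)
    \<comment> \<open>Members of \<open>F\<close> through an edge of \<open>T\<close> are discarded,
      as \<open>ex_disjoint_pair\<close> demands. \<open>T\<close> has at most five edges, none in
      \<open>S\<close>, each in at most a fraction \<open>1 / R \<le> 1 / 64\<close> of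
      \<open>F\<close>; so at least half remains, still spread with bound
      \<open>card F\<close>.\<close>
    define H where "H = {\<sigma>\<in>F. edges n \<sigma> \<inter> T = {}}"
    have HF: "H \<subseteq> F" by (auto simp: H_def)
    have hit: "card {\<sigma>\<in>F. e \<in> edges n \<sigma>} * R \<le> card F" if "e \<in> T" for e
    proof -
      have "card {\<sigma>\<in>F. {e} \<subseteq> edges n \<sigma> - S} * R ^ card {e} \<le> card F"
        using S(4) unfolding F_def spread_def by blast
      moreover have "e \<notin> S" using that TS by auto
      ultimately show ?thesis by simp
    qed
    have "card F \<le> 2 * card H"
    proof -
      have FH: "F - H = (\<Union>e\<in>T. {\<sigma>\<in>F. e \<in> edges n \<sigma>})" by (auto simp: H_def)
      have "card (F - H) * R \<le> (\<Sum>e\<in>T. card {\<sigma>\<in>F. e \<in> edges n \<sigma>}) * R"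
        unfolding FH by (intro mult_le_mono1 card_UN_le T(1))
      also have "\<dots> = (\<Sum>e\<in>T. card {\<sigma>\<in>F. e \<in> edges n \<sigma>} * R)" by (rule sum_distrib_right)
      also have "\<dots> \<le> (\<Sum>e\<in>T. card F)" by (rule sum_mono) (rule hit)
      also have "\<dots> \<le> 5 * card F" using \<open>card T < 6\<close> by simp
      finally have "64 * card (F - H) \<le> 5 * card F" using mult_le_mono2[OF R, of "card (F - H)"] by linarith
      moreover have "card F = card H + card (F - H)"
        using card_Diff_subset[of H F] card_mono[OF finF HF] HF finF finite_subset by fastforce
      ultimately show ?thesis by linarith
    qed
    moreover have "H \<noteq> {}" using \<open>card F \<le> 2 * card H\<close> F0 finF by auto
    moreover have "spread (Q\<^sup>2) (card F) H (\<lambda>\<sigma>. edges n \<sigma> - S)" unfolding spread_def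
    proof (intro allI impI)
      fix U :: "(nat \<times> nat) set" assume U: "finite U"
      have "card {\<sigma>\<in>H. U \<subseteq> edges n \<sigma> - S} \<le> card {\<sigma>\<in>F. U \<subseteq> edges n \<sigma> - S}"
        by (rule card_mono) (use finF HF in auto)
      then have "card {\<sigma>\<in>H. U \<subseteq> edges n \<sigma> - S} * R ^ card U \<le> card {\<sigma>\<in>F. U \<subseteq> edges n \<sigma> - S} * R ^ card U"
        by (rule mult_le_mono1)
      also have "\<dots> \<le> card F" using S(4) U by (simp add: spread_def F_def)
      finally show "card {\<sigma>\<in>H. U \<subseteq> edges n \<sigma> - S} * Q\<^sup>2 ^ card U \<le> card F" by (simp add: R_def)
    qed
    ultimately have "\<exists>f\<in>H. \<exists>g\<in>G. \<forall>i\<in>{1..n}. f i \<noteq> g i"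
      using T(4) G BS FA HF A(1)
      by (intro ex_disjoint_pair[where S = S and T = T and NF = "card F" and NG = "card G", OF _ _ _ _ _ _ _ _ _ _ n m])
        (auto simp: R_def G_def H_def)
    then show False using noFG[of H G] HF FA G by blast
  qed
  then show ?thesis using abn unfolding B_def by blast
qed

section \<open>Derangements and double translates\<close>

definition derangements :: "'a set \<Rightarrow> ('a \<Rightarrow> 'a) set" where
  "derangements S = {p. p permutes S \<and> (\<forall>x\<in>S. p x \<noteq> x)}"

lemma finite_derangements: "finite S \<Longrightarrow> finite (derangements S)"
  unfolding derangements_def by (rule finite_subset[OF _ finite_permutations]) auto

lemma card_derangements:
  assumes "finite S"
  shows "card (derangements S) = num_derangements (card S)"
proof -
  obtain f where f: "bij_betw f {1..card S} S"
    using ex_bij_betw_nat_finite_1[OF assms] by blast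
  let ?A = "{1..card S}"
  let ?g = "\<lambda>p x. if x \<in> S then f (p (inv_into ?A f x)) else x"
  have g: "bij_betw ?g {p. p permutes ?A} {p. p permutes S}" by (rule bij_betw_permutations[OF f])
  have iff: "(\<forall>x\<in>S. ?g p x \<noteq> x) \<longleftrightarrow> (\<forall>i\<in>?A. p i \<noteq> i)" if p: "p permutes ?A" for p
  proof -
    have "?g p (f i) = f i \<longleftrightarrow> p i = i" if i: "i \<in> ?A" for i
    proof -
      have "inv_into ?A f (f i) = i" "f i \<in> S" "p i \<in> ?A"
        using f i p permutes_in_image[OF p] by (auto simp: bij_betw_def)
      then show ?thesis using f i by (auto simp: bij_betw_def inj_on_eq_iff)
    qed
    moreover have "S = f ` ?A" using f by (simp add: bij_betw_def)
    ultimately show ?thesis by (metis (no_types, lifting) image_iff)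
  qed
  have inj: "inj_on ?g {p. p permutes ?A}" using g by (simp add: bij_betw_def)
  have "derangements S = ?g ` derangements ?A"
  proof (intro equalityI subsetI)
    fix q assume q: "q \<in> derangements S"
    then have "q \<in> ?g ` {p. p permutes ?A}" using g by (simp add: bij_betw_def derangements_def)
    then obtain p where p: "p permutes ?A" "q = ?g p" by blast
    moreover have "\<forall>x\<in>S. ?g p x \<noteq> x" using q p(2) by (auto simp: derangements_def)
    ultimately show "q \<in> ?g ` derangements ?A" using iff[OF p(1)] by (auto simp: derangements_def)
  next
    fix q assume "q \<in> ?g ` derangements ?A"
    then obtain p where p: "p permutes ?A" "\<forall>i\<in>?A. p i \<noteq> i" "q = ?g p" by (auto simp: derangements_def)
    have "?g p permutes S" using p(1) g by (auto simp: bij_betw_def)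
    moreover have "\<forall>x\<in>S. ?g p x \<noteq> x" using iff[OF p(1)] p(2) by blast
    ultimately show "q \<in> derangements S" unfolding derangements_def p(3) by blast
  qed
  then have "card (derangements S) = card (derangements ?A)"
    using card_image[OF inj_on_subset[OF inj, of "derangements ?A"]] by (auto simp: derangements_def)
  then show ?thesis by (simp add: derangements_def num_derangements_def)
qed

text \<open>\<open>p \<circ> transpose j x\<close> splices \<open>x\<close> into the cycle of
  \<open>p\<close> right after \<open>j\<close>; \<open>j\<close> is recovered as the preimage of
  \<open>x\<close>.\<close>

lemma card_derangements_insert:
  assumes S: "finite S" "x \<notin> S"
  shows "card S * card (derangements S) \<le> card (derangements (insert x S))"
proof -
  let ?f = "\<lambda>(j, p). p \<circ> transpose j x"
  have "card (S \<times> derangements S) \<le> card (derangements (insert x S))"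
  proof (rule card_inj_on_le[of ?f])
    have px: "p x = x" if "p \<in> derangements S" for p
      using that S by (auto simp: derangements_def permutes_def)
    show "inj_on ?f (S \<times> derangements S)"
    proof (rule inj_onI, clarify)
      fix j p k q assume j: "j \<in> S" "k \<in> S" and pq: "p \<in> derangements S" "q \<in> derangements S"
        and eq: "p \<circ> transpose j x = q \<circ> transpose k x"
      have q: "inj q" using pq by (auto simp: derangements_def permutes_inj)
      have "q (transpose k x j) = p (transpose j x j)" using fun_cong[OF eq, of j] by simp
      also have "\<dots> = q x" using px[OF pq(1)] px[OF pq(2)] by simp
      finally have "transpose k x j = x" using q by (simp add: inj_eq)
      then have jk: "j = k" using j S by (auto simp: transpose_def split: if_splits)
      have "p \<circ> transpose j x \<circ> transpose j x = q \<circ> transpose j x \<circ> transpose j x" using eq jk by simp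
      then show "j = k \<and> p = q" using jk by (simp add: comp_assoc)
    qed
    show "?f ` (S \<times> derangements S) \<subseteq> derangements (insert x S)"
    proof clarify
      fix j p assume j: "j \<in> S" and p: "p \<in> derangements S"
      have pp: "p permutes S" using p by (simp add: derangements_def)
      have "(p \<circ> transpose j x) permutes insert x S"
        by (rule permutes_compose[OF permutes_swap_id permutes_subset[OF pp]]) (use j in auto)
      moreover have "(p \<circ> transpose j x) y \<noteq> y" if "y \<in> insert x S" for y
      proof -
        have "p y \<noteq> y" if "y \<in> S" for y using p that by (simp add: derangements_def)
        moreover have "p j \<in> S" using permutes_in_image[OF pp] j by simp
        ultimately show ?thesis using that j S px[OF p] by (auto simp: transpose_def)
      qed
      ultimately show "p \<circ> transpose j x \<in> derangements (insert x S)" unfolding derangements_def by blast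
    qed
    show "finite (derangements (insert x S))" using S by (simp add: finite_derangements)
  qed
  then show ?thesis by (simp add: card_cartesian_product)
qed

text \<open>Iterating \<open>card_derangements_insert\<close> from the derangement of a two-element
  set gives \<open>(m - 1)!\<close> for \<open>m\<close> points, of lower order than
  \<open>m! / e\<close> but sufficient.\<close>

lemma fact_le_card_derangements:
  assumes "finite S" "card S = Suc (Suc k)"
  shows "fact (Suc k) \<le> card (derangements S)"
  using assms
proof (induction k arbitrary: S)
  case 0
  then obtain x y where xy: "S = {x, y}" "x \<noteq> y" by (auto simp: card_Suc_eq)
  have "transpose x y \<in> derangements S"
    using xy by (auto simp: derangements_def transpose_def intro: permutes_swap_id)
  then show ?case using finite_derangements[OF 0(1)] by (auto simp: Suc_le_eq card_gt_0_iff)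
next
  case (Suc k)
  then obtain x T where xT: "S = insert x T" "x \<notin> T" "card T = Suc (Suc k)"
    by (metis card_eq_SucD)
  then have T: "finite T" using Suc.prems by auto
  have "fact (Suc (Suc k)) \<le> card T * card (derangements T)"
    using Suc.IH[OF T xT(3)] xT(3) by (simp only: fact_Suc of_nat_id mult_le_mono2)
  then show ?case using card_derangements_insert[OF T xT(2)] xT(1) by simp
qed

lemma inj_on_compose_left: "inj f \<Longrightarrow> inj_on (\<lambda>g. f \<circ> g) X"
  by (auto simp: inj_on_def fun_eq_iff)

text \<open>A derangement of \<open>{a, i, u, v}\<close> with the prescribed values is combined with
  any derangement of the remaining points. At least \<open>n - 4\<close> points remain, and
  \<open>fact_le_card_derangements\<close> loses one more.\<close>

lemma card_derangements_two_values:
  assumes n: "n \<ge> 6" and in_n: "a \<in> {1..n}" "i \<in> {1..n}" "u \<in> {1..n}" "v \<in> {1..n}"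
    and ne: "a \<noteq> i" "u \<noteq> v" "u \<noteq> a" "v \<noteq> i"
  shows "fact (n - 5) \<le> card {p \<in> derangements {1..n}. p a = u \<and> p i = v}"
proof -
  define X where "X = {a, i, u, v}"
  have fX: "finite X" and XN: "X \<subseteq> {1..n}" using in_n by (auto simp: X_def)
  \<comment> \<open>The coincidences \<open>u = i\<close> and \<open>v = a\<close> decide the cycle
    structure: one transposition if both hold, a 3-cycle if one does, two disjoint transpositions if
    neither does.\<close>
  have "\<exists>p. p permutes X \<and> (\<forall>x\<in>X. p x \<noteq> x) \<and> p a = u \<and> p i = v"
  proof -
    consider "u = i" "v = a" | "u = i" "v \<noteq> a" | "u \<noteq> i" "v = a" | "u \<noteq> i" "v \<noteq> a" by blast
    then show ?thesis
    proof cases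
      case 1
      then show ?thesis using ne
        by (intro exI[of _ "transpose a i"]) (auto simp: X_def transpose_def intro: permutes_swap_id)
    next
      case 2
      then show ?thesis using ne
        by (intro exI[of _ "transpose a i \<circ> transpose i v"])
          (auto simp: X_def transpose_def intro!: permutes_compose permutes_swap_id)
    next
      case 3
      then show ?thesis using ne
        by (intro exI[of _ "transpose i a \<circ> transpose a u"])
          (auto simp: X_def transpose_def intro!: permutes_compose permutes_swap_id)
    next
      case 4
      then show ?thesis using ne
        by (intro exI[of _ "transpose a u \<circ> transpose i v"])
          (auto simp: X_def transpose_def intro!: permutes_compose permutes_swap_id)
    qed
  qed
  then obtain p where p: "p permutes X" "\<forall>x\<in>X. p x \<noteq> x" "p a = u" "p i = v" by blast
  let ?D = "derangements ({1..n} - X)"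
  have cX: "card X \<le> 4" unfolding X_def by (simp add: card_insert_if)
  have "card ({1..n} - X) = n - card X" using XN fX by (simp add: card_Diff_subset)
  then have "card ({1..n} - X) = Suc (Suc (n - card X - 2))" using cX n by simp
  from fact_le_card_derangements[OF _ this]
  have "fact (Suc (n - card X - 2)) \<le> card ?D" by simp
  moreover have "fact (n - 5) \<le> (fact (Suc (n - card X - 2)) :: nat)" by (rule fact_mono) (use cX n in simp)
  ultimately have "fact (n - 5) \<le> card ?D" by simp
  also have "\<dots> \<le> card {p \<in> derangements {1..n}. p a = u \<and> p i = v}"
  proof (rule card_inj_on_le[of "\<lambda>d. p \<circ> d"])
    show "inj_on (\<lambda>d. p \<circ> d) ?D"
      by (rule inj_on_compose_left[OF permutes_inj[OF p(1)]])
    show "(\<lambda>d. p \<circ> d) ` ?D \<subseteq> {p \<in> derangements {1..n}. p a = u \<and> p i = v}"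
    proof clarify
      fix d assume d: "d \<in> ?D"
      have dp: "d permutes {1..n} - X" using d by (simp add: derangements_def)
      have dX: "d x = x" if "x \<in> X" for x using dp that by (simp add: permutes_def)
      have pX: "p x = x" if "x \<notin> X" for x using p(1) that by (simp add: permutes_def)
      have "(p \<circ> d) permutes {1..n}"
        by (rule permutes_compose[OF permutes_subset[OF dp] permutes_subset[OF p(1) XN]]) auto
      moreover have "(p \<circ> d) x \<noteq> x" if "x \<in> {1..n}" for x
      proof (cases "x \<in> X")
        case True then show ?thesis using p(2) dX by simp
      next
        case False
        then have "d x \<in> {1..n} - X" using permutes_in_image[OF dp, of x] that by simp
        then have "p (d x) = d x" by (intro pX) simp
        moreover have "d x \<noteq> x" using d False that by (simp add: derangements_def)
        ultimately show ?thesis by simp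
      qed
      moreover have "(p \<circ> d) a = u" "(p \<circ> d) i = v" using dX p by (auto simp: X_def)
      ultimately show "p \<circ> d \<in> derangements {1..n} \<and> (p \<circ> d) a = u \<and> (p \<circ> d) i = v"
        by (simp add: derangements_def)
    qed
    show "finite {p \<in> derangements {1..n}. p a = u \<and> p i = v}" by (simp add: finite_derangements)
  qed
  finally show ?thesis .
qed

text \<open>For \<open>\<tau> a \<noteq> b\<close> these are the members of the star of
  \<open>(a, b)\<close> that can share an intersecting family with \<open>\<tau>\<close>.\<close>

definition hitting_star :: "nat \<Rightarrow> nat \<Rightarrow> nat \<Rightarrow> (nat \<Rightarrow> nat) \<Rightarrow> (nat \<Rightarrow> nat) set" where
  "hitting_star n a b \<tau> = {\<sigma>\<in>Sym n. \<sigma> a = b \<and> (\<exists>i\<in>{1..n}. \<sigma> i = \<tau> i)}"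

text \<open>If \<open>\<sigma> 1 = 1\<close>, agreement with the transposition fails at 1, which it
  sends to 2, and at 2, since \<open>\<sigma> 2 \<noteq> 1\<close>; beyond 2 the transposition is
  the identity.\<close>

lemma Cfam_eq: "Cfam n = insert (transpose 1 2) (hitting_star n 1 1 (transpose 1 2))"
proof -
  have "(\<exists>i\<in>{1..n}. i > 2 \<and> \<sigma> i = i) \<longleftrightarrow> (\<exists>i\<in>{1..n}. \<sigma> i = transpose 1 2 i)"
    if \<sigma>: "\<sigma> \<in> Sym n" "\<sigma> 1 = 1" for \<sigma>
  proof -
    have "inj \<sigma>" using \<sigma> by (auto simp: Sym_def permutes_inj)
    then have "\<sigma> 2 \<noteq> 1" using \<sigma>(2) by (metis inj_eq numeral_One numeral_eq_iff semiring_norm(85))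
    have "i > 2 \<and> \<sigma> i = i \<longleftrightarrow> \<sigma> i = transpose 1 2 i" if "i \<in> {1..n}" for i
    proof -
      consider "i = 1" | "i = 2" | "i > 2" using \<open>i \<in> {1..n}\<close> by (cases "i = 1"; cases "i = 2"; simp; linarith)
      then show ?thesis using \<sigma>(2) \<open>\<sigma> 2 \<noteq> 1\<close> by cases auto
    qed
    then show ?thesis by blast
  qed
  then show ?thesis by (auto simp: Cfam_def hitting_star_def)
qed

section \<open>Double translates of hitting stars\<close>

lemma Sym_compose: "p \<in> Sym n \<Longrightarrow> q \<in> Sym n \<Longrightarrow> p \<circ> q \<in> Sym n"
  by (simp add: Sym_def permutes_compose)

lemma Sym_inv: "p \<in> Sym n \<Longrightarrow> inv p \<in> Sym n"
  by (simp add: Sym_def permutes_inv)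

lemma double_translate_hitting_star_subset:
  assumes p: "p \<in> Sym n" and q: "q \<in> Sym n"
  shows "double_translate p (hitting_star n a b \<tau>) q \<subseteq> hitting_star n (inv q a) (p b) (p \<circ> \<tau> \<circ> q)"
proof -
  have qi: "q (inv q x) = x" for x using q permutes_inverses(1) by (auto simp: Sym_def)
  show ?thesis
  proof (clarsimp simp: double_translate_def hitting_star_def qi, intro conjI)
    fix \<sigma> i assume \<sigma>: "\<sigma> \<in> Sym n" and i: "Suc 0 \<le> i" "i \<le> n" "\<sigma> i = \<tau> i"
    show "p \<circ> \<sigma> \<circ> q \<in> Sym n" by (intro Sym_compose p q \<sigma>)
    have "inv q permutes {1..n}" using q by (simp add: Sym_def permutes_inv)
    then have "inv q i \<in> {1..n}" using permutes_in_image[of "inv q" "{1..n}" i] i by simp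
    then show "\<exists>i\<in>{Suc 0..n}. p (\<sigma> (q i)) = p (\<tau> (q i))"
      by (intro bexI[of _ "inv q i"]) (use i qi in auto)
  qed
qed

text \<open>The reverse inclusion is the forward one applied to \<open>inv p\<close> and
  \<open>inv q\<close>.\<close>

lemma double_translate_hitting_star:
  assumes p: "p \<in> Sym n" and q: "q \<in> Sym n"
  shows "double_translate p (hitting_star n a b \<tau>) q = hitting_star n (inv q a) (p b) (p \<circ> \<tau> \<circ> q)"
proof
  show "double_translate p (hitting_star n a b \<tau>) q \<subseteq> hitting_star n (inv q a) (p b) (p \<circ> \<tau> \<circ> q)"
    by (rule double_translate_hitting_star_subset[OF p q])
  have pp: "p permutes {1..n}" and qq: "q permutes {1..n}" using p q by (auto simp: Sym_def)
  note inv = permutes_inverses[OF pp] permutes_inverses[OF qq]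
  show "hitting_star n (inv q a) (p b) (p \<circ> \<tau> \<circ> q) \<subseteq> double_translate p (hitting_star n a b \<tau>) q"
  proof
    fix \<sigma> assume \<sigma>: "\<sigma> \<in> hitting_star n (inv q a) (p b) (p \<circ> \<tau> \<circ> q)"
    have "inv p \<circ> (p \<circ> \<tau> \<circ> q) \<circ> inv q = \<tau>" by (simp add: fun_eq_iff inv)
    moreover have "inv (inv q) (inv q a) = a" using inv permutes_inv_inv[OF qq] by simp
    ultimately have "double_translate (inv p) (hitting_star n (inv q a) (p b) (p \<circ> \<tau> \<circ> q)) (inv q)
        \<subseteq> hitting_star n a b \<tau>"
      using double_translate_hitting_star_subset[OF Sym_inv[OF p] Sym_inv[OF q], of "inv q a" "p b" "p \<circ> \<tau> \<circ> q"]
      by (simp add: inv)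
    then have "inv p \<circ> \<sigma> \<circ> inv q \<in> hitting_star n a b \<tau>" using \<sigma> by (auto simp: double_translate_def)
    moreover have "\<sigma> = p \<circ> (inv p \<circ> \<sigma> \<circ> inv q) \<circ> q" by (simp add: fun_eq_iff inv)
    ultimately show "\<sigma> \<in> double_translate p (hitting_star n a b \<tau>) q"
      unfolding double_translate_def by blast
  qed
qed

lemma card_double_translate:
  assumes "p \<in> Sym n" "q \<in> Sym n"
  shows "card (double_translate p C q) = card C"
  unfolding double_translate_def
proof (rule card_image, rule inj_onI)
  have pp: "p permutes {1..n}" and qq: "q permutes {1..n}" using assms by (auto simp: Sym_def)
  fix x y assume eq: "p \<circ> x \<circ> q = p \<circ> y \<circ> q"
  show "x = y"
  proof
    fix i
    have "p (x i) = p (y i)" using fun_cong[OF eq, of "inv q i"] permutes_inverses[OF qq] by simp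
    then show "x i = y i" using permutes_inj[OF pp] by (simp add: inj_eq)
  qed
qed

text \<open>\<open>q\<close> is built to send \<open>a\<close> to 1 and the preimage
  \<open>c\<close> of \<open>b\<close> under \<open>\<tau>\<close> to 2. Then \<open>p\<close> is
  solved from \<open>p \<circ> transpose 1 2 \<circ> q = \<tau>\<close>, which forces
  \<open>p 1 = \<tau> c = b\<close>.\<close>

lemma insert_hitting_star_double_translate:
  assumes n: "n \<ge> 2" and ab: "a \<in> {1..n}" "b \<in> {1..n}" and \<tau>: "\<tau> \<in> Sym n" "\<tau> a \<noteq> b"
  shows "\<exists>p\<in>Sym n. \<exists>q\<in>Sym n. insert \<tau> (hitting_star n a b \<tau>) = double_translate p (Cfam n) q"
proof -
  have t\<tau>: "\<tau> permutes {1..n}" using \<tau> by (simp add: Sym_def)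
  note invt = permutes_inverses[OF t\<tau>]
  define c where "c = inv \<tau> b"
  have c: "c \<in> {1..n}" "c \<noteq> a"
    using permutes_in_image[OF permutes_inv[OF t\<tau>], of b] ab \<tau>(2) invt by (auto simp: c_def)
  \<comment> \<open>The position of \<open>c\<close> after the swap of \<open>a\<close> and 1. As
    \<open>d \<noteq> 1\<close>, swapping \<open>d\<close> with 2 then leaves the image 1 of
    \<open>a\<close> in place.\<close>
  define d where "d = transpose a 1 c"
  have d: "d \<in> {1..n}" "d \<noteq> 1" using c ab n by (auto simp: d_def transpose_def)
  define q where "q = transpose d 2 \<circ> transpose a 1"
  have q: "q \<in> Sym n" unfolding q_def Sym_def
    using n ab d by (auto intro!: permutes_compose permutes_swap_id)
  then have qq: "q permutes {1..n}" by (simp add: Sym_def)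
  note invq = permutes_inverses[OF qq]
  have qa: "q a = 1" and qc: "q c = 2" using d(2) by (simp_all add: q_def flip: One_nat_def d_def)
  have t: "transpose 1 2 \<in> Sym n" using n by (auto simp: Sym_def intro: permutes_swap_id)
  define p where "p = \<tau> \<circ> inv q \<circ> transpose 1 2"
  have p: "p \<in> Sym n" unfolding p_def by (intro Sym_compose Sym_inv \<tau> q t)
  have iq: "inv q 1 = a" "inv q 2 = c" using invq qa qc by metis+
  have "p 1 = b" using iq by (simp add: p_def c_def invt)
  moreover have pt: "p \<circ> transpose 1 2 \<circ> q = \<tau>" by (simp add: p_def fun_eq_iff invq)
  ultimately have "double_translate p (hitting_star n 1 1 (transpose 1 2)) q = hitting_star n a b \<tau>"
    using double_translate_hitting_star[OF p q, of 1 1 "transpose 1 2"] iq by simp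
  then have "double_translate p (Cfam n) q = insert \<tau> (hitting_star n a b \<tau>)"
    unfolding Cfam_eq using pt by (simp add: double_translate_def)
  then show ?thesis using p q by metis
qed

section \<open>The extremal family\<close>

lemma Sym_fixing: "{\<sigma>\<in>Sym n. \<forall>x\<in>X. \<sigma> x = x} = {p. p permutes {1..n} - X}"
proof (intro equalityI subsetI)
  fix p assume "p \<in> {\<sigma>\<in>Sym n. \<forall>x\<in>X. \<sigma> x = x}"
  then show "p \<in> {p. p permutes {1..n} - X}"
    by (auto simp: Sym_def intro: permutes_superset)
next
  fix p assume "p \<in> {p. p permutes {1..n} - X}"
  then have p: "p permutes {1..n} - X" by simp
  then have "p permutes {1..n}" by (rule permutes_subset) auto
  moreover have "\<forall>x\<in>X. p x = x" using p by (simp add: permutes_def)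
  ultimately show "p \<in> {\<sigma>\<in>Sym n. \<forall>x\<in>X. \<sigma> x = x}" by (simp add: Sym_def)
qed

lemma card_Sym_fixing:
  assumes "X \<subseteq> {1..n}"
  shows "card {\<sigma>\<in>Sym n. \<forall>x\<in>X. \<sigma> x = x} = fact (n - card X)"
  unfolding Sym_fixing
  by (rule card_permutations) (use assms finite_subset[OF assms] in \<open>auto simp: card_Diff_subset\<close>)

lemma finite_Cfam: "finite (Cfam n)"
  by (simp add: Cfam_def finite_Sym)

text \<open>A permutation fixing 1 but no point above 2 is a derangement of \<open>{2..n}\<close> or
  of \<open>{3..n}\<close>, according to whether it moves or fixes 2. The final 1 is the
  transposition.\<close>

lemma card_Cfam:
  assumes n: "n \<ge> 2"
  shows "int (card (Cfam n)) = int (fact (n - 1)) - int (num_derangements (n - 1))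
           - int (num_derangements (n - 2)) + 1"
proof -
  define St where "St = {\<sigma>\<in>Sym n. \<forall>x\<in>{1}. \<sigma> x = x}"
  define H where "H = {\<sigma>\<in>Sym n. \<sigma> 1 = 1 \<and> (\<exists>i\<in>{1..n}. i > 2 \<and> \<sigma> i = i)}"
  have finSt: "finite St" by (simp add: St_def finite_Sym)
  have D1: "{2..n} = {1..n} - {1}" by auto
  have D2: "{3..n} = {1..n} - {1, 2}" by auto
  have mem1: "p permutes {2..n} \<longleftrightarrow> p \<in> Sym n \<and> p 1 = 1" for p
    using Sym_fixing[of n "{1}"] unfolding D1 by (simp add: set_eq_iff)
  have mem2: "p permutes {3..n} \<longleftrightarrow> p \<in> Sym n \<and> p 1 = 1 \<and> p 2 = 2" for p
    using Sym_fixing[of n "{1, 2}"] unfolding D2 by (simp add: set_eq_iff)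
  have split: "St - H = derangements {2..n} \<union> derangements {3..n}"
  proof (intro equalityI subsetI)
    fix p assume p: "p \<in> St - H"
    have 3: "p x \<noteq> x" if "x \<in> {3..n}" for x using p that by (auto simp: St_def H_def)
    have p1: "p \<in> Sym n" "p 1 = 1" using p by (auto simp: St_def)
    show "p \<in> derangements {2..n} \<union> derangements {3..n}"
    proof (cases "p 2 = 2")
      case True
      then show ?thesis using 3 p1 by (simp add: derangements_def mem2)
    next
      case False
      have "p x \<noteq> x" if "x \<in> {2..n}" for x
        using False 3[of x] that by (cases "x = 2") auto
      then show ?thesis using p1 by (simp add: derangements_def mem1)
    qed
  next
    fix p assume p: "p \<in> derangements {2..n} \<union> derangements {3..n}"
    then have "p \<in> Sym n" "p 1 = 1" by (auto simp: derangements_def mem1 mem2)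
    moreover have "p x \<noteq> x" if "x \<in> {1..n}" "x > 2" for x
      using p that by (auto simp: derangements_def)
    ultimately show "p \<in> St - H" by (auto simp: St_def H_def)
  qed
  have disj: "derangements {2..n} \<inter> derangements {3..n} = {}"
    using n by (auto simp: derangements_def mem2)
  have HSt: "H \<subseteq> St" by (auto simp: H_def St_def)
  have "card (St - H) = num_derangements (n - 1) + num_derangements (n - 2)"
    unfolding split by (subst card_Un_disjoint) (use disj in \<open>simp_all add: finite_derangements card_derangements numeral_2_eq_2 numeral_3_eq_3\<close>)
  moreover have "card St = fact (n - 1)" unfolding St_def by (subst card_Sym_fixing) (use n in auto)
  moreover have "card St = card H + card (St - H)"
    using card_Diff_subset[of H St] card_mono[OF finSt HSt] finite_subset[OF HSt finSt] HSt by simp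
  moreover have "card (Cfam n) = Suc (card H)"
  proof -
    have "Cfam n = insert (transpose 1 2) H" by (auto simp: Cfam_def H_def)
    moreover have "transpose 1 2 \<notin> H" by (simp add: H_def)
    ultimately show ?thesis using finite_subset[OF HSt finSt] by simp
  qed
  ultimately have "int (fact (n - 1)) = int (card H + (num_derangements (n - 1) + num_derangements (n - 2)))"
    "card (Cfam n) = Suc (card H)" by presburger+
  then show ?thesis by linarith
qed

text \<open>For a set \<open>J\<close> of \<open>j\<close> points above 2, the permutations fixing 1
  and, within \<open>J\<close>, exactly \<open>i\<close> form disjoint parts \<open>P i\<close> of
  \<open>Cfam n\<close>. Each keeps at least half of the \<open>fact (n - 2)\<close> permutations
  fixing 1 and \<open>i\<close>, as at most \<open>j * fact (n - 3)\<close> of these fix a further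
  point of \<open>J\<close>.\<close>

lemma card_Cfam_lower_bound:
  assumes n: "2 * j + 4 \<le> n"
  shows "j * fact (n - 2) \<le> 2 * card (Cfam n)"
proof -
  define J where "J = {3..j + 2}"
  have J: "finite J" "card J = j" "J \<subseteq> {1..n}" using n by (auto simp: J_def)
  define P where "P i = {\<sigma>\<in>Sym n. \<sigma> 1 = 1 \<and> \<sigma> i = i \<and> (\<forall>k\<in>J - {i}. \<sigma> k \<noteq> k)}" for i
  have finP: "finite (P i)" for i by (simp add: P_def finite_Sym)
  have P: "fact (n - 2) \<le> 2 * card (P i)" if i: "i \<in> J" for i
  proof -
    define U where "U X = {\<sigma>\<in>Sym n. \<forall>x\<in>X. \<sigma> x = x}" for X
    have i1: "i \<noteq> 1" using i by (simp add: J_def)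
    have finU: "finite (U X)" for X by (simp add: U_def finite_Sym)
    have "{1, i} \<subseteq> {1..n}" "card {1, i} = 2" using i J i1 n by auto
    then have "fact (n - 2) = card (U {1, i})" unfolding U_def by (simp only: card_Sym_fixing)
    also have "\<dots> \<le> card (P i \<union> (\<Union>k\<in>J - {i}. U {1, i, k}))"
    proof (rule card_mono)
      show "finite (P i \<union> (\<Union>k\<in>J - {i}. U {1, i, k}))" using finP finU J by blast
      show "U {1, i} \<subseteq> P i \<union> (\<Union>k\<in>J - {i}. U {1, i, k})" unfolding P_def U_def by blast
    qed
    also have "\<dots> \<le> card (P i) + card (\<Union>k\<in>J - {i}. U {1, i, k})" by (rule card_Un_le)
    also have "card (\<Union>k\<in>J - {i}. U {1, i, k}) \<le> (\<Sum>k\<in>J - {i}. card (U {1, i, k}))"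
      by (rule card_UN_le) (use J in simp)
    also have "\<dots> = (\<Sum>k\<in>J - {i}. fact (n - 3))"
    proof (rule sum.cong[OF refl])
      fix k assume k: "k \<in> J - {i}"
      then have "card {1, i, k} = 3" using i1 by (auto simp: J_def)
      moreover have "{1, i, k} \<subseteq> {1..n}" using i k J n by auto
      ultimately show "card (U {1, i, k}) = fact (n - 3)" unfolding U_def by (simp only: card_Sym_fixing)
    qed
    also have "\<dots> \<le> j * fact (n - 3)" using J by (simp add: card_Diff_singleton_if)
    finally have "fact (n - 2) \<le> card (P i) + j * fact (n - 3)" by simp
    moreover have "2 * (j * fact (n - 3)) \<le> (fact (n - 2) :: nat)"
    proof -
      have "n - 2 = Suc (n - 3)" using n by simp
      then have "fact (n - 2) = (n - 2) * (fact (n - 3) :: nat)" by (metis fact_Suc of_nat_id)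
      moreover have "2 * j * fact (n - 3) \<le> (n - 2) * (fact (n - 3) :: nat)"
        by (rule mult_le_mono1) (use n in simp)
      ultimately show ?thesis by simp
    qed
    ultimately show ?thesis by linarith
  qed
  have "j * fact (n - 2) = (\<Sum>i\<in>J. fact (n - 2))" using J by simp
  also have "\<dots> \<le> (\<Sum>i\<in>J. 2 * card (P i))" by (rule sum_mono) (rule P)
  also have "\<dots> = 2 * (\<Sum>i\<in>J. card (P i))" by (simp add: sum_distrib_left)
  also have "(\<Sum>i\<in>J. card (P i)) = card (\<Union>i\<in>J. P i)"
    by (rule card_UN_disjoint[symmetric]) (use J finP in \<open>auto simp: P_def\<close>)
  also have "card (\<Union>i\<in>J. P i) \<le> card (Cfam n)"
    by (rule card_mono[OF finite_Cfam]) (use J in \<open>auto simp: P_def Cfam_def J_def\<close>)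
  finally show ?thesis by simp
qed

section \<open>Two permutations outside a star\<close>

lemma ex_separating_position:
  assumes \<tau>: "\<tau> \<in> Sym n" "\<tau> a \<noteq> b" and \<tau>': "\<tau>' \<in> Sym n" "\<tau>' a \<noteq> b" and ne: "\<tau> \<noteq> \<tau>'"
  shows "\<exists>i\<in>{1..n}. i \<noteq> a \<and> \<tau> i \<noteq> b \<and> \<tau> i \<noteq> \<tau>' i"
proof (rule ccontr)
  assume "\<not> ?thesis"
  moreover have p: "\<tau> permutes {1..n}" "\<tau>' permutes {1..n}" using \<tau> \<tau>' by (auto simp: Sym_def)
  then have "\<tau> i = \<tau>' i" if "i \<notin> {1..n}" for i using that by (simp add: permutes_def)
  ultimately have agree: "i = a \<or> \<tau> i = b \<or> \<tau> i = \<tau>' i" for i by blast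
  note inj = permutes_inj[OF p(1)] permutes_inj[OF p(2)]
  \<comment> \<open>The point that \<open>\<tau>'\<close> sends to \<open>b\<close> is not
    \<open>a\<close>, so \<open>\<tau>\<close> sends it to \<open>b\<close> as well. Hence both
    permutations agree off \<open>a\<close>, and by bijectivity also at \<open>a\<close>.\<close>
  obtain x where x: "\<tau>' x = b" using permutes_surj[OF p(2)] by (metis surjD)
  have agree': "i = a \<or> \<tau> i = \<tau>' i" for i
  proof -
    have "\<tau> x = b" using agree[of x] x \<tau>'(2) by auto
    then show ?thesis using agree[of i] x inj by (metis injD)
  qed
  obtain y where y: "\<tau>' y = \<tau> a" using permutes_surj[OF p(2)] by (metis surjD)
  then have "y = a" using agree'[of y] inj by (metis injD)
  then have "\<tau> = \<tau>'" using agree' y by (metis ext)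
  then show False using ne by simp
qed

text \<open>For a derangement \<open>d\<close>, \<open>\<tau>' \<circ> d\<close> agrees with
  \<open>\<tau>'\<close> nowhere. Prescribing \<open>d a = u\<close> puts it into the star, and
  \<open>d i = v\<close> makes it agree with \<open>\<tau>\<close> at \<open>i\<close>.\<close>

lemma card_hitting_avoiding:
  assumes n: "n \<ge> 6" and ab: "a \<in> {1..n}" "b \<in> {1..n}"
    and \<tau>: "\<tau> \<in> Sym n" "\<tau> a \<noteq> b" and \<tau>': "\<tau>' \<in> Sym n" "\<tau>' a \<noteq> b" and ne: "\<tau> \<noteq> \<tau>'"
  shows "fact (n - 5) \<le> card (hitting_star n a b \<tau> - hitting_star n a b \<tau>')"
proof -
  \<comment> \<open>\<open>\<tau> i \<noteq> b\<close> and
    \<open>\<tau> i \<noteq> \<tau>' i\<close> become \<open>u \<noteq> v\<close> and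
    \<open>v \<noteq> i\<close> below.\<close>
  obtain i where i: "i \<in> {1..n}" "i \<noteq> a" "\<tau> i \<noteq> b" "\<tau> i \<noteq> \<tau>' i"
    using ex_separating_position[OF \<tau> \<tau>' ne] by blast
  have p: "\<tau> permutes {1..n}" "\<tau>' permutes {1..n}" using \<tau> \<tau>' by (auto simp: Sym_def)
  note inv = permutes_inverses[OF p(2)]
  define u where "u = inv \<tau>' b"
  define v where "v = inv \<tau>' (\<tau> i)"
  have \<tau>u: "\<tau>' u = b" and \<tau>v: "\<tau>' v = \<tau> i" by (simp_all add: u_def v_def inv)
  have uv: "u \<in> {1..n}" "v \<in> {1..n}"
    using permutes_in_image[OF permutes_inv[OF p(2)]] permutes_in_image[OF p(1)] ab i
    by (auto simp: u_def v_def)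
  have "fact (n - 5) \<le> card {p \<in> derangements {1..n}. p a = u \<and> p i = v}"
    by (rule card_derangements_two_values[OF n ab(1) i(1) uv]) (use i \<tau>u \<tau>v \<tau>'(2) in auto)
  also have "\<dots> \<le> card (hitting_star n a b \<tau> - hitting_star n a b \<tau>')"
  proof (rule card_inj_on_le[of "\<lambda>d. \<tau>' \<circ> d"])
    show "inj_on (\<lambda>d. \<tau>' \<circ> d) {p \<in> derangements {1..n}. p a = u \<and> p i = v}"
      by (rule inj_on_compose_left[OF permutes_inj[OF p(2)]])
    show "(\<lambda>d. \<tau>' \<circ> d) ` {p \<in> derangements {1..n}. p a = u \<and> p i = v}
        \<subseteq> hitting_star n a b \<tau> - hitting_star n a b \<tau>'"
    proof (rule image_subsetI)
      fix d assume "d \<in> {p \<in> derangements {1..n}. p a = u \<and> p i = v}"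
      then have d: "d \<in> derangements {1..n}" and da: "u = d a" and di: "v = d i" by auto
      have "d \<in> Sym n" using d by (simp add: derangements_def Sym_def)
      then have "\<tau>' \<circ> d \<in> hitting_star n a b \<tau>"
        using \<tau>u \<tau>v da di i Sym_compose[OF \<tau>'(1)] by (auto simp: hitting_star_def)
      moreover have "\<tau>' (d x) \<noteq> \<tau>' x" if "x \<in> {1..n}" for x
        using d that permutes_inj[OF p(2)] by (auto simp: derangements_def inj_eq)
      ultimately show "\<tau>' \<circ> d \<in> hitting_star n a b \<tau> - hitting_star n a b \<tau>'"
        by (auto simp: hitting_star_def)
    qed
    show "finite (hitting_star n a b \<tau> - hitting_star n a b \<tau>')"
      by (simp add: hitting_star_def finite_Sym)
  qed
  finally show ?thesis .
qed

lemma large_non_centred_intersecting: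
  assumes A: "A \<subseteq> Sym n" "intersecting n A" "\<not> centred n A"
    and n: "n < 2 ^ m" and m: "m > 0" "8 * m \<le> Q" and Rn: "(Q\<^sup>2) ^ 6 + 10 \<le> n"
    and big: "card (Cfam n) \<le> card A"
  shows "\<exists>p\<in>Sym n. \<exists>q\<in>Sym n. A = double_translate p (Cfam n) q"
proof -
  have n6: "n \<ge> 6" using Rn by simp
  have finA: "finite A" using A finite_Sym finite_subset by blast
  have "(Q\<^sup>2)\<^sup>2 * fact (n - 2) < card A"
  proof -
    define R where "R = Q\<^sup>2"
    have "8\<^sup>2 \<le> Q\<^sup>2" by (rule power_mono) (use m in auto)
    then have R: "R \<ge> 64" by (simp add: R_def)
    have "4 * R\<^sup>2 \<le> R ^ 4 * R\<^sup>2" using power_mono[OF R, of 4] by (intro mult_le_mono1) simp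
    also have "\<dots> = R ^ 6" by (simp flip: power_add)
    \<comment> \<open>This permits \<open>j = 2 * R\<^sup>2 + 1\<close> in
      \<open>card_Cfam_lower_bound\<close>; half of it still exceeds
      \<open>R\<^sup>2\<close>.\<close>
    finally have "2 * (2 * R\<^sup>2 + 1) + 4 \<le> n" using Rn by (simp add: R_def)
    from card_Cfam_lower_bound[OF this]
    have "2 * (R\<^sup>2 * fact (n - 2)) + fact (n - 2) \<le> 2 * card (Cfam n)" by (simp add: algebra_simps)
    moreover have "(fact (n - 2) :: nat) > 0" by simp
    ultimately have "R\<^sup>2 * fact (n - 2) < card (Cfam n)" by linarith
    then show ?thesis using big by (simp add: R_def)
  qed
  then obtain a b where ab: "a \<in> {1..n}" "b \<in> {1..n}" and small: "card {\<sigma>\<in>A. \<sigma> a \<noteq> b} < fact (n - 5)"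
    using intersecting_concentrated[OF A(1,2) n m Rn] by blast
  define B where "B = {\<sigma>\<in>A. \<sigma> a \<noteq> b}"
  have finB: "finite B" using finA by (simp add: B_def)
  obtain \<tau> where \<tau>: "\<tau> \<in> A" "\<tau> a \<noteq> b" using A(3) ab unfolding centred_def by blast
  have \<tau>S: "\<tau> \<in> Sym n" using \<tau> A by auto
  let ?H = "hitting_star n a b"
  have finH: "finite (?H t)" for t by (simp add: hitting_star_def finite_Sym)
  have AB: "A - B \<subseteq> ?H t" if "t \<in> A" for t
    using that A by (auto simp: B_def hitting_star_def intersecting_def)
  obtain p q where pq: "p \<in> Sym n" "q \<in> Sym n" "insert \<tau> (?H \<tau>) = double_translate p (Cfam n) q"
    using insert_hitting_star_double_translate[OF _ ab \<tau>S \<tau>(2)] n6 by auto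
  have "card (Cfam n) = card (insert \<tau> (?H \<tau>))" using pq card_double_translate by metis
  then have cH: "card (Cfam n) = Suc (card (?H \<tau>))"
    using finH \<tau>(2) by (simp add: hitting_star_def finite_Sym)
  have "B = {\<tau>}"
  proof (rule ccontr)
    assume "B \<noteq> {\<tau>}"
    then obtain t where t: "t \<in> A" "t a \<noteq> b" "\<tau> \<noteq> t" using \<tau> by (auto simp: B_def)
    \<comment> \<open>Members of \<open>A\<close> in the star meet both \<open>\<tau>\<close> and
      \<open>t\<close>. Passing from \<open>?H \<tau>\<close> to
      \<open>?H \<tau> \<inter> ?H t\<close> loses at least \<open>fact (n - 5)\<close>, more than
      \<open>B\<close> contributes, so \<open>A\<close> would be smaller than
      \<open>Cfam n\<close>.\<close>
    have "card A \<le> card (A - B) + card B"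
      using card_Un_le[of "A - B" B] by (simp add: B_def Un_absorb2)
    also have "card (A - B) \<le> card (?H \<tau> \<inter> ?H t)"
      by (rule card_mono) (use finH AB \<tau> t in auto)
    also have "card B < fact (n - 5)" using small by (simp add: B_def)
    also have "fact (n - 5) \<le> card (?H \<tau> - ?H t)"
      by (rule card_hitting_avoiding[OF n6 ab \<tau>S \<tau>(2) _ t(2,3)]) (use t A in auto)
    also have "card (?H \<tau> \<inter> ?H t) + card (?H \<tau> - ?H t) = card (?H \<tau>)"
      using card_Int_Diff[of "?H \<tau>" "?H t"] finH by simp
    finally show False using big cH by simp
  qed
  then have "A \<subseteq> insert \<tau> (?H \<tau>)" using AB[OF \<tau>(1)] by auto
  moreover have "card (insert \<tau> (?H \<tau>)) \<le> card A"
    using big \<open>card (Cfam n) = card (insert \<tau> (?H \<tau>))\<close> by simp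
  ultimately have "A = insert \<tau> (?H \<tau>)" using finH by (intro card_seteq) auto
  then show ?thesis using pq by blast
qed

section \<open>How large \<open>n\<close> must be\<close>

lemma poly_le_two_power:
  assumes "j \<ge> 182"
  shows "((8 * Suc j)\<^sup>2) ^ 6 + 10 \<le> (2::nat) ^ j"
proof -
  \<comment> \<open>From \<open>8 * 26 \<le> 2 ^ 8\<close> comes
    \<open>8 * Suc j \<le> 2 ^ (8 + k)\<close>; the twelfth power and the summand 10 need
    \<open>97 + 12 * k \<le> j\<close>. As \<open>26 * k \<le> Suc j\<close>, this holds from
    \<open>k = 7\<close> on, whence \<open>182 = 26 * 7\<close>.\<close>
  define k where "k = Suc j div 26"
  have k: "k \<ge> 7" "26 * k \<le> Suc j" "Suc j \<le> 26 * Suc k" using assms by (auto simp: k_def)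
  have "8 * Suc j \<le> 2 ^ 8 * Suc k" using k by simp
  also have "\<dots> \<le> 2 ^ 8 * 2 ^ k" by (intro mult_le_mono2 Suc_leI less_exp)
  also have "\<dots> = 2 ^ (8 + k)" by (simp only: power_add)
  finally have "(8 * Suc j) ^ 12 \<le> (2 ^ (8 + k)) ^ 12" by (rule power_mono) simp
  also have "\<dots> = (2::nat) ^ (96 + 12 * k)" by (simp add: power_mult[symmetric] algebra_simps)
  finally have 1: "(8 * Suc j) ^ 12 \<le> (2::nat) ^ (96 + 12 * k)" .
  have "(2::nat) ^ 4 \<le> 2 ^ (96 + 12 * k)" by (rule power_increasing) auto
  then have "10 \<le> (2::nat) ^ (96 + 12 * k)" by simp
  with 1 have "(8 * Suc j) ^ 12 + 10 \<le> (2::nat) ^ Suc (96 + 12 * k)"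
    unfolding power_Suc mult_2 by (rule add_mono)
  also have "\<dots> \<le> 2 ^ j" by (rule power_increasing) (use k in auto)
  finally show ?thesis by (simp add: power_mult[symmetric])
qed

theorem theorem7:
  "\<exists>n0::nat. \<forall>n\<ge>n0.
     int (card (Cfam n)) = int (fact (n - 1)) - int (num_derangements (n - 1))
                           - int (num_derangements (n - 2)) + 1
   \<and> (\<forall>A. A \<subseteq> Sym n \<and> intersecting n A \<and> \<not> centred n A \<longrightarrow>
         card A \<le> card (Cfam n)
       \<and> (card A = card (Cfam n) \<longleftrightarrow>
            (\<exists>\<pi>\<in>Sym n. \<exists>\<tau>\<in>Sym n. A = double_translate \<pi> (Cfam n) \<tau>)))"
proof (intro exI[of _ "2 ^ 182"] allI impI)
  fix n :: nat assume n: "2 ^ 182 \<le> n"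
  \<comment> \<open>\<open>Suc j\<close> serves as \<open>m\<close> and \<open>8 * Suc j\<close> as
    \<open>Q\<close>; both are logarithmic in \<open>n\<close>.\<close>
  obtain j where j: "2 ^ j \<le> n" "n < 2 ^ Suc j" using ex_power_ivl1[of 2 n] n by auto
  have "(2::nat) ^ 182 < 2 ^ Suc j" using n j(2) by (rule le_less_trans)
  then have "182 < Suc j" by (rule power_less_imp_less_exp[rotated]) simp
  then have bound: "((8 * Suc j)\<^sup>2) ^ 6 + 10 \<le> n" using poly_le_two_power[of j] j by linarith
  have extremal: "\<exists>\<pi>\<in>Sym n. \<exists>\<tau>\<in>Sym n. A = double_translate \<pi> (Cfam n) \<tau>"
    if "A \<subseteq> Sym n \<and> intersecting n A \<and> \<not> centred n A" "card (Cfam n) \<le> card A" for A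
    using large_non_centred_intersecting[OF _ _ _ j(2) _ order_refl bound] that by blast
  \<comment> \<open>A family at least as large as \<open>Cfam n\<close> is a translate of it, hence
    of equal size; this settles the bound and the equality case together.\<close>
  have "card A \<le> card (Cfam n)
       \<and> (card A = card (Cfam n) \<longleftrightarrow>
            (\<exists>\<pi>\<in>Sym n. \<exists>\<tau>\<in>Sym n. A = double_translate \<pi> (Cfam n) \<tau>))"
    if "A \<subseteq> Sym n \<and> intersecting n A \<and> \<not> centred n A" for A
    using extremal[OF that] card_double_translate[of _ n _ "Cfam n"] by (metis nle_le)
  moreover have "n \<ge> 2" using bound by simp
  ultimately show "int (card (Cfam n)) = int (fact (n - 1)) - int (num_derangements (n - 1))
                           - int (num_derangements (n - 2)) + 1
   \<and> (\<forall>A. A \<subseteq> Sym n \<and> intersecting n A \<and> \<not> centred n A \<longrightarrow>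
         card A \<le> card (Cfam n)
       \<and> (card A = card (Cfam n) \<longleftrightarrow>
            (\<exists>\<pi>\<in>Sym n. \<exists>\<tau>\<in>Sym n. A = double_translate \<pi> (Cfam n) \<tau>)))"
    using card_Cfam by blast
qed

end
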